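(* Let $\mathcal{A}$ be an abstract continued fraction, let $\{I_i\}_{0\le i<n}$ be unimodular intervals, one for each node, and let $(\mathcal{G}_{\mathcal{A}},\{B_a\}_{a\in\mathcal{A}})$ be the graph-directed iterated function system thus determined, with coding map $\pi$ and attractor components $H_i=\pi[E_i^\omega]$. (1) There exists a number $M\ge1$, depending on $\mathcal{A}$ only, such that for every node $i_0$ and every $x_0\in H_{i_0}$ the cardinality of the fiber $\pi^{-1}(x_0)\subseteq E_{i_0}^\omega$ is bounded by $M$. (2) If the fiber $\pi^{-1}(x_0)\subseteq E_{i_0}^\omega$ contains a purely periodic sequence, then it has cardinality $1$.
   Context: **Codes.** $\Sigma$ is the monoid generated by $l,n,f$ modulo $fl=nf$, $fn=lf$, $ff=\epsilon$ (identity). Every $\sigma\in\Sigma$ is uniquely a free word $w$ in $l,n$, possibly followed by a single $f$; $\ell(\sigma)$ is the length of $w$. Given nodes $\{0,\ldots,n-1\}$, $n\ge1$ (the integer $n$ is not to be confused with the letter $n$), let $\widetilde\Sigma=\{i\sigma j:\sigma\in\Sigma,\ i,j \text{ nodes}\}$ with partial product $(i\sigma j)(j\tau k)=i\sigma\tau k$ (undefined when the inner nodes differ) and $\ell(i\sigma j)=\ell(\sigma)$. A code is a subset $\mathcal{A}\subset\widetilde\Sigma$ such that whenever two products $a_1\cdots a_r$ and $b_1\cdots b_s$ of elements of $\mathcal{A}$ are defined and equal in $\widetilde\Sigma$, then $r=s$ and $a_k=b_k$ for all $k$. For finite $\mathcal{A}$, $\mathcal{G}_{\mathcal{A}}$ is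 the directed graph on the nodes whose set of edges from $i$ to $j$ is $E_{ij}=\{\text{elements of }\mathcal{A}\text{ of the form }i\sigma j\}$; $E_i^\omega$ is the set of infinite paths starting at $i$. $G_{\mathcal{A}}$ is the $n\times n$ matrix with $ij$-entry $\sum_{a\in E_{ij}}2^{-\ell(a)}$. An abstract continued fraction is a finite code $\mathcal{A}$ with $\mathcal{G}_{\mathcal{A}}$ strongly connected and $G_{\mathcal{A}}$ of spectral radius $1$. **Intervals and maps.** Matrices act on $\mathrm{P}^1\mathbb{R}=\mathbb{R}\cup\{\infty\}$ by Möbius maps; $\mathrm{PSL}_2^\pm\mathbb{Z}$ is the group of integer $2\times2$ matrices of determinant $\pm1$ modulo $\pm1$. $\mathrm{Proj}:\Sigma\to\mathrm{PSL}^\pm_2\mathbb{Z}$ is the monoid homomorphism with $l\mapsto\begin{bmatrix}1&0\\1&1\end{bmatrix}$, $n\mapsto\begin{bmatrix}1&1\\0&1\end{bmatrix}$, $f\mapsto\begin{bmatrix}0&1\\1&0\end{bmatrix}$. Unimodular intervals are the images of $[0,\infty]$ under elements of $\mathrm{PSL}_2\mathbb{Z}$; the matrix $\begin{bmatrix}p'&p\\ q'&q\end{bmatrix}$ corresponds bijectively to the closed interval $[p/q,p'/q']$ going counterclockwise (in the increasing direction, possibly through $\infty$) from $p/q$ to $p'/q'$; the same letter denotes interval and matrix. For $a=i\sigma j\in\mathcal{A}$ put $B_a=I_i\,\mathrm{Proj}(\sigma)I_j^{-1}$, which maps $I_j$ into $I_i$; $B_{a_0\ldots a_{t-1}}=B_{a_0}\cdots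 B_{a_{t-1}}$. **Coding map.** For $\mathbf{a}=a_0a_1\ldots\in E_{i_0}^\omega$ with $a_t=i_t\sigma_ti_{t+1}$, $\pi(\mathbf{a})\in I_{i_0}$ is the unique point of $\bigcap_{t\ge0}B_{a_0\ldots a_{t-1}}I_{i_t}$. The sets $H_i$ are regarded as lying in disjoint copies of $\mathrm{P}^1\mathbb{R}$, so that for $x_0\in H_{i_0}$ the fiber $\pi^{-1}(x_0)$ consists of sequences in $E_{i_0}^\omega$. A sequence is purely periodic if it has the form $(a_0\ldots a_{p-1})^\omega$ with $p\ge1$. *)

theory Defs
  imports
    "Jordan_Normal_Form.Spectral_Radius"
    "Graph_Theory.Digraph_Component"
begin

section \<open>The monoid \<open>\<Sigma>\<close>\<close>

datatype letter = L | N | F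

inductive sigma_step :: "letter list \<Rightarrow> letter list \<Rightarrow> bool" where
  FL: "sigma_step (u @ [F, L] @ v) (u @ [N, F] @ v)"
| FN: "sigma_step (u @ [F, N] @ v) (u @ [L, F] @ v)"
| FF: "sigma_step (u @ [F, F] @ v) (u @ v)"

quotient_type sigma = "letter list" / "equivclp sigma_step"
  morphisms rep_sigma word
  by simp

lemma sigma_step_ctxt:
  "sigma_step a b \<Longrightarrow> sigma_step (x @ a @ y) (x @ b @ y)"
proof (induction rule: sigma_step.induct)
  case (FL u v) then show ?case using sigma_step.FL[of "x @ u" "v @ y"] by simp
next
  case (FN u v) then show ?case using sigma_step.FN[of "x @ u" "v @ y"] by simp
next
  case (FF u v) then show ?case using sigma_step.FF[of "x @ u" "v @ y"] by simp
qed

lemma equivclp_sigma_ctxt: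
  "equivclp sigma_step a b \<Longrightarrow> equivclp sigma_step (x @ a @ y) (x @ b @ y)"
proof (induction rule: equivclp_induct)
  case base then show ?case by simp
next
  case (step b c)
  from step(2) have "equivclp sigma_step (x @ b @ y) (x @ c @ y)"
    using sigma_step_ctxt by (metis r_into_equivclp equivclp_sym)
  with step(3) show ?case by (rule equivclp_trans)
qed

instantiation sigma :: monoid_mult
begin

lift_definition one_sigma :: sigma is "[]" .

lift_definition times_sigma :: "sigma \<Rightarrow> sigma \<Rightarrow> sigma" is "(@)"
proof -
  fix a b c d
  assume "equivclp sigma_step a b" "equivclp sigma_step c d"
  then have "equivclp sigma_step (a @ c) (b @ c)" "equivclp sigma_step (b @ c) (b @ d)"
    using equivclp_sigma_ctxt[of a b "[]" c] equivclp_sigma_ctxt[of c d b "[]"] by simp_all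
  then show "equivclp sigma_step (a @ c) (b @ d)" by (rule equivclp_trans)
qed

instance by standard (transfer; simp)+

end

text \<open>The length of the free word in the normal form; \<open>sigma_length_word\<close> below shows that
  the description is proper and amounts to counting the letters different from \<^const>\<open>F\<close>.\<close>

definition sigma_length :: "sigma \<Rightarrow> nat" where
  "sigma_length \<sigma> = (THE k. \<exists>w. set w \<subseteq> {L, N} \<and> (\<sigma> = word w \<or> \<sigma> = word w * word [F]) \<and> k = length w)"

lift_definition count_LN :: "sigma \<Rightarrow> nat" is "\<lambda>w. length (filter (\<lambda>x. x \<noteq> F) w)"
proof -
  fix a b assume "equivclp sigma_step a b"
  then show "length (filter (\<lambda>x. x \<noteq> F) a) = length (filter (\<lambda>x. x \<noteq> F) b)"
    by (induction rule: equivclp_induct) (auto elim!: sigma_step.cases)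
qed

lemma word_mult: "word u * word v = word (u @ v)"
  by (rule times_sigma.abs_eq)

lemma F_commute:
  assumes "set w \<subseteq> {L, N}"
  shows "\<exists>w'. set w' \<subseteq> {L, N} \<and> word (F # w) = word (w' @ [F])"
  using assms
proof (induction w)
  case Nil then show ?case by (intro exI[of _ "[]"]) simp
next
  case (Cons x w)
  then obtain w' where w': "set w' \<subseteq> {L, N}" "word (F # w) = word (w' @ [F])" by auto
  from Cons.prems have "x = L \<or> x = N" by auto
  then obtain y where y: "y \<in> {L, N}" "word [F, x] = word [y, F]"
    using sigma_step.FL[of "[]" "[]"] sigma_step.FN[of "[]" "[]"]
    by (auto simp: sigma.abs_eq_iff intro: r_into_equivclp)
  have "word (F # x # w) = word [F, x] * word w" by (simp add: word_mult)
  also have "\<dots> = word [y] * word (F # w)" by (simp add: y word_mult)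
  also have "\<dots> = word ((y # w') @ [F])" by (simp add: w' word_mult)
  finally show ?case using w' y by (intro exI[of _ "y # w'"]) auto
qed

lemma sigma_normal_form:
  "\<exists>w. set w \<subseteq> {L, N} \<and> (\<sigma> = word w \<or> \<sigma> = word w * word [F])"
proof -
  have "\<exists>w. set w \<subseteq> {L, N} \<and> (word u = word w \<or> word u = word w * word [F])" for u
  proof (induction u)
    case Nil then show ?case by (intro exI[of _ "[]"]) simp
  next
    case (Cons x u)
    then obtain w where w: "set w \<subseteq> {L, N}" "word u = word w \<or> word u = word w * word [F]"
      by auto
    have xu: "word (x # u) = word [x] * word u" by (simp add: word_mult)
    show ?case
    proof (cases "x = F")
      case False
      then have "x = L \<or> x = N" by (cases x) auto
      then have "set (x # w) \<subseteq> {L, N}" using w(1) by auto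
      moreover have "word (x # u) = word (x # w) \<or> word (x # u) = word (x # w) * word [F]"
        using w(2)
      proof
        assume "word u = word w"
        then show ?thesis unfolding xu by (simp add: word_mult)
      next
        assume u: "word u = word w * word [F]"
        show ?thesis unfolding xu u by (simp add: word_mult)
      qed
      ultimately show ?thesis by blast
    next
      case True
      from F_commute[OF w(1)] obtain w' where
        w': "set w' \<subseteq> {L, N}" "word (F # w) = word (w' @ [F])" by auto
      have FF: "word [F, F] = 1"
        using sigma_step.FF[of "[]" "[]"]
        by (auto simp: sigma.abs_eq_iff one_sigma.abs_eq intro: r_into_equivclp)
      have Fw: "word [F] * word w = word (w' @ [F])"
        using w'(2) by (simp add: word_mult)
      have "word (x # u) = word (w' @ [F]) \<or> word (x # u) = word (w' @ [F]) * word [F]"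
        using w(2)
      proof
        assume u: "word u = word w"
        show ?thesis unfolding True xu[unfolded True] u Fw by simp
      next
        assume u: "word u = word w * word [F]"
        show ?thesis unfolding True xu[unfolded True] u mult.assoc[symmetric] Fw by simp
      qed
      moreover have "word (w' @ [F]) * word [F] = word w'"
        by (metis FF append.assoc append_Cons append_Nil mult.right_neutral word_mult)
      moreover have "word (w' @ [F]) = word w' * word [F]" by (simp add: word_mult)
      ultimately show ?thesis using w'(1) by metis
    qed
  qed
  then show ?thesis by (induction \<sigma> rule: sigma.abs_induct) auto
qed

lemma sigma_length_word: "sigma_length (word u) = length (filter (\<lambda>x. x \<noteq> F) u)"
proof -
  have *: "k = count_LN (word u)"
    if "set w \<subseteq> {L, N}" "word u = word w \<or> word u = word w * word [F]" "k = length w" for k w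
  proof -
    have "filter (\<lambda>x. x \<noteq> F) w = w" using that(1) by (auto intro!: filter_True)
    then have "count_LN (word w) = k" "count_LN (word w * word [F]) = k"
      using that(3) by (simp_all add: word_mult count_LN.abs_eq)
    then show ?thesis using that(2) by metis
  qed
  obtain w where w: "set w \<subseteq> {L, N}" "word u = word w \<or> word u = word w * word [F]"
    using sigma_normal_form by blast
  have "sigma_length (word u) = count_LN (word u)"
    unfolding sigma_length_def
  proof (rule the_equality)
    show "\<exists>w. set w \<subseteq> {L, N} \<and> (word u = word w \<or> word u = word w * word [F]) \<and>
        count_LN (word u) = length w"
      using w *[OF w refl, symmetric] by (intro exI[of _ w] conjI)
  next
    fix k assume "\<exists>w. set w \<subseteq> {L, N} \<and> (word u = word w \<or> word u = word w * word [F]) \<and> k = length w"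
    then obtain w' where "set w' \<subseteq> {L, N}" "word u = word w' \<or> word u = word w' * word [F]" "k = length w'"
      by blast
    then show "k = count_LN (word u)" by (rule *)
  qed
  then show ?thesis by (simp add: count_LN.abs_eq)
qed

section \<open>Codes and abstract continued fractions\<close>

text \<open>The triple \<open>(i, \<sigma>, j)\<close> is the element \<open>i\<sigma>j\<close>; the nodes are \<open>{..<n}\<close>.\<close>

type_synonym edge = "nat \<times> sigma \<times> nat"

abbreviation src :: "edge \<Rightarrow> nat" where "src a \<equiv> fst a"
abbreviation lab :: "edge \<Rightarrow> sigma" where "lab a \<equiv> fst (snd a)"
abbreviation tgt :: "edge \<Rightarrow> nat" where "tgt a \<equiv> snd (snd a)"

definition edges_over :: "nat \<Rightarrow> edge set" where
  "edges_over n = {..<n} \<times> UNIV \<times> {..<n}"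

definition edge_mult :: "edge \<Rightarrow> edge \<Rightarrow> edge option" where
  "edge_mult a b = (if tgt a = src b then Some (src a, lab a * lab b, tgt b) else None)"

text \<open>\<open>None\<close> stands for an undefined product.
  Only products of at least one element are considered: there is no global unit.\<close>

fun edge_prod :: "edge list \<Rightarrow> edge option" where
  "edge_prod [] = None"
| "edge_prod [a] = Some a"
| "edge_prod (a # b # as) = Option.bind (edge_prod (b # as)) (edge_mult a)"

definition is_code :: "nat \<Rightarrow> edge set \<Rightarrow> bool" where
  "is_code n A \<longleftrightarrow> A \<subseteq> edges_over n \<and>
     (\<forall>as bs. set as \<subseteq> A \<and> set bs \<subseteq> A \<and> edge_prod as \<noteq> None \<and> edge_prod as = edge_prod bs
        \<longrightarrow> as = bs)"

definition code_graph :: "nat \<Rightarrow> edge set \<Rightarrow> (nat, edge) pre_digraph" where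
  "code_graph n A = \<lparr>verts = {..<n}, arcs = A, tail = src, head = tgt\<rparr>"

definition edges_between :: "edge set \<Rightarrow> nat \<Rightarrow> nat \<Rightarrow> edge set" where
  "edges_between A i j = {a \<in> A. src a = i \<and> tgt a = j}"

definition code_matrix :: "nat \<Rightarrow> edge set \<Rightarrow> real mat" where
  "code_matrix n A = mat n n (\<lambda>(i, j). \<Sum>a\<in>edges_between A i j. (1/2) ^ sigma_length (lab a))"

definition abstract_cf :: "nat \<Rightarrow> edge set \<Rightarrow> bool" where
  "abstract_cf n A \<longleftrightarrow> n \<ge> 1 \<and> finite A \<and> is_code n A \<and>
     strongly_connected (code_graph n A) \<and>
     spectral_radius (map_mat complex_of_real (code_matrix n A)) = 1"

definition E_omega :: "edge set \<Rightarrow> nat \<Rightarrow> (nat \<Rightarrow> edge) set" where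
  "E_omega A i = {a. (\<forall>t. a t \<in> A \<and> tgt (a t) = src (a (Suc t))) \<and> src (a 0) = i}"

definition purely_periodic :: "(nat \<Rightarrow> 'a) \<Rightarrow> bool" where
  "purely_periodic a \<longleftrightarrow> (\<exists>w. w \<noteq> [] \<and> a = (\<lambda>t. w ! (t mod length w)))"

section \<open>The group \<open>PSL\<^sub>2\<^sup>\<plusminus>(\<int>)\<close> and its action\<close>

abbreviation mat2 :: "int \<Rightarrow> int \<Rightarrow> int \<Rightarrow> int \<Rightarrow> int mat" where
  "mat2 a b c d \<equiv> mat_of_rows_list 2 [[a, b], [c, d]]"

lemma mat2_carrier: "mat2 a b c d \<in> carrier_mat 2 2"
  by (rule carrier_matI) (simp_all add: mat_of_rows_list_def)

lemma mat2_index [simp]: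
  "mat2 a b c d $$ (0,0) = a" "mat2 a b c d $$ (0,Suc 0) = b"
  "mat2 a b c d $$ (Suc 0,0) = c" "mat2 a b c d $$ (Suc 0,Suc 0) = d"
  by (simp_all add: mat_of_rows_list_def)

lemma mat_2x2_eqI:
  assumes "A \<in> carrier_mat 2 2" "B \<in> carrier_mat 2 2"
    "A $$ (0,0) = B $$ (0,0)" "A $$ (0,1) = B $$ (0,1)"
    "A $$ (1,0) = B $$ (1,0)" "A $$ (1,1) = B $$ (1,1)"
  shows "A = B"
proof (rule eq_matI)
  fix i j assume "i < dim_row B" "j < dim_col B"
  then have "i = 0 \<or> i = 1" "j = 0 \<or> j = 1" using assms(2) by auto
  then show "A $$ (i, j) = B $$ (i, j)" using assms by auto
qed (use assms in auto)

lemma mult_2x2_index: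
  assumes "A \<in> carrier_mat 2 2" "B \<in> carrier_mat 2 2" "i < 2" "j < 2"
  shows "(A * B) $$ (i, j) = A $$ (i, 0) * B $$ (0, j) + A $$ (i, 1) * B $$ (1, j)"
  using assms by (simp add: scalar_prod_def numeral_2_eq_2)

lemma det_2x2:
  assumes A: "A \<in> carrier_mat 2 2"
  shows "det (A :: int mat) = A $$ (0,0) * A $$ (1,1) - A $$ (0,1) * A $$ (1,0)"
proof -
  have d: "mat_delete A 0 j \<in> carrier_mat 1 1" for j
    using mat_delete_carrier[OF A, of 0 j] by simp
  have "det A = (\<Sum>j<2. A $$ (0, j) * cofactor A 0 j)"
    by (rule laplace_expansion_row[OF A]) simp
  also have "\<dots> = A $$ (0,0) * A $$ (1,1) - A $$ (0,1) * A $$ (1,0)"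
    using A by (simp add: numeral_2_eq_2 cofactor_def det_single[OF d]) (simp add: mat_delete_def)
  finally show ?thesis .
qed

lemma det_mat2: "det (mat2 a b c d) = a * d - b * c"
  by (simp add: det_2x2[OF mat2_carrier])

lemma uminus_mat2:
  "A \<in> carrier_mat 2 2 \<Longrightarrow>
   mat2 ((- A) $$ (1,1)) (- (- A) $$ (0,1)) (- (- A) $$ (1,0)) ((- A) $$ (0,0)) =
   - mat2 (A $$ (1,1)) (- A $$ (0,1)) (- A $$ (1,0)) (A $$ (0,0))"
  by (rule mat_2x2_eqI) (auto simp: mat_of_rows_list_def)

text \<open>A partial equivalence relation: its domain consists of the integer matrices of
  determinant \<open>\<plusminus>1\<close>, which it identifies up to sign.\<close>

definition psl_rel :: "int mat \<Rightarrow> int mat \<Rightarrow> bool" where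
  "psl_rel A B \<longleftrightarrow> A \<in> carrier_mat 2 2 \<and> B \<in> carrier_mat 2 2 \<and> \<bar>det A\<bar> = 1 \<and> (B = A \<or> B = - A)"

lemma det_uminus2: "A \<in> carrier_mat 2 2 \<Longrightarrow> det (- A :: int mat) = det A"
proof -
  assume A: "A \<in> carrier_mat 2 2"
  have "- A = (-1) \<cdot>\<^sub>m A" by (rule eq_matI) auto
  then show ?thesis using A by simp
qed

lemma uminus_uminus2: "- (- A) = (A :: int mat)"
  by (rule eq_matI) auto

quotient_type psl = "int mat" / partial: psl_rel
  morphisms rep_psl psl_of_mat
proof (rule part_equivpI)
  show "\<exists>x. psl_rel x x" by (rule exI[of _ "1\<^sub>m 2"]) (simp add: psl_rel_def)
  show "symp psl_rel"
    by (rule sympI) (auto simp: psl_rel_def det_uminus2 uminus_uminus2)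
  show "transp psl_rel"
    by (rule transpI) (auto simp: psl_rel_def uminus_uminus2)
qed

instantiation psl :: monoid_mult
begin

lift_definition one_psl :: psl is "1\<^sub>m 2" by (simp add: psl_rel_def)

lift_definition times_psl :: "psl \<Rightarrow> psl \<Rightarrow> psl" is "(*)"
  by (auto simp: psl_rel_def det_mult[of _ 2] abs_mult uminus_uminus2
      uminus_mult_left_mat uminus_mult_right_mat)

instance
  by standard (transfer; auto simp: psl_rel_def det_mult[of _ 2] abs_mult assoc_mult_mat[of _ 2 2 _ 2 _ 2])+

end

text \<open>Up to sign, the inverse is the adjugate matrix.\<close>

lift_definition psl_inv :: "psl \<Rightarrow> psl" is
  "\<lambda>A. mat2 (A $$ (1,1)) (- A $$ (0,1)) (- A $$ (1,0)) (A $$ (0,0))"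
proof -
  fix A B assume AB: "psl_rel A B"
  have *: "psl_rel A' B'"
    if "A' \<in> carrier_mat 2 2" "\<bar>det A'\<bar> = 1" "B' = A' \<or> B' = - A'" for A' B' :: "int mat"
    using that by (auto simp: psl_rel_def)
  show "psl_rel (mat2 (A $$ (1,1)) (- A $$ (0,1)) (- A $$ (1,0)) (A $$ (0,0)))
                (mat2 (B $$ (1,1)) (- B $$ (0,1)) (- B $$ (1,0)) (B $$ (0,0)))"
  proof (rule *)
    have "det (mat2 (A $$ (1,1)) (- A $$ (0,1)) (- A $$ (1,0)) (A $$ (0,0))) = det A"
      using AB by (simp add: det_mat2 det_2x2 psl_rel_def algebra_simps)
    then show "\<bar>det (mat2 (A $$ (1,1)) (- A $$ (0,1)) (- A $$ (1,0)) (A $$ (0,0)))\<bar> = 1"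
      using AB by (simp add: psl_rel_def)
    show "mat2 (B $$ (1,1)) (- B $$ (0,1)) (- B $$ (1,0)) (B $$ (0,0)) =
        mat2 (A $$ (1,1)) (- A $$ (0,1)) (- A $$ (1,0)) (A $$ (0,0)) \<or>
      mat2 (B $$ (1,1)) (- B $$ (0,1)) (- B $$ (1,0)) (B $$ (0,0)) =
        - mat2 (A $$ (1,1)) (- A $$ (0,1)) (- A $$ (1,0)) (A $$ (0,0))"
      using AB uminus_mat2[of A] unfolding psl_rel_def by metis
  qed (rule mat2_carrier)
qed

lemma psl_inv: "g * psl_inv g = 1 \<and> psl_inv g * g = 1"
proof (transfer)
  fix A assume A: "psl_rel A A"
  let ?A' = "mat2 (A $$ (1,1)) (- A $$ (0,1)) (- A $$ (1,0)) (A $$ (0,0))"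
  have d: "det A = 1 \<or> det A = - 1" and c: "A \<in> carrier_mat 2 2"
    using A by (auto simp: psl_rel_def)
  have eq: "A * ?A' = det A \<cdot>\<^sub>m 1\<^sub>m 2" "?A' * A = det A \<cdot>\<^sub>m 1\<^sub>m 2"
    by (rule mat_2x2_eqI;
        use c mat2_carrier mult_carrier_mat[OF c mat2_carrier] mult_carrier_mat[OF mat2_carrier c] in
        \<open>simp add: mult_2x2_index[of _ _ 0] mult_2x2_index[of _ _ "Suc 0"] det_2x2 algebra_simps\<close>)+
  have m: "(-1) \<cdot>\<^sub>m 1\<^sub>m 2 = - (1\<^sub>m 2 :: int mat)" "(1::int) \<cdot>\<^sub>m 1\<^sub>m 2 = 1\<^sub>m 2"
    by (rule eq_matI; simp)+
  have r: "psl_rel (1\<^sub>m 2) (1\<^sub>m 2)" "psl_rel (- (1\<^sub>m 2)) (1\<^sub>m 2)"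
    by (auto simp: psl_rel_def det_uminus2 uminus_uminus2)
  show "psl_rel (A * ?A') (1\<^sub>m 2) \<and> psl_rel (?A' * A) (1\<^sub>m 2)"
    unfolding eq using d by (elim disjE) (simp_all only: m r simp_thms)
qed

text \<open>The determinant is well defined since the matrices have even size.\<close>

lift_definition psl_det :: "psl \<Rightarrow> int" is det
  by (auto simp: psl_rel_def det_uminus2)

definition PSL2Z :: "psl set" where
  "PSL2Z = {g. psl_det g = 1}"

fun Proj_letter :: "letter \<Rightarrow> psl" where
  "Proj_letter L = psl_of_mat (mat2 1 0 1 1)"
| "Proj_letter N = psl_of_mat (mat2 1 1 0 1)"
| "Proj_letter F = psl_of_mat (mat2 0 1 1 0)"

lemma psl_of_mat2_mult:
  assumes "\<bar>a * d - b * c\<bar> = 1" "\<bar>a' * d' - b' * c'\<bar> = 1"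
  shows "psl_of_mat (mat2 a b c d) * psl_of_mat (mat2 a' b' c' d') =
    psl_of_mat (mat2 (a * a' + b * c') (a * b' + b * d') (c * a' + d * c') (c * b' + d * d'))"
proof -
  have "mat2 a b c d * mat2 a' b' c' d' =
    mat2 (a * a' + b * c') (a * b' + b * d') (c * a' + d * c') (c * b' + d * d')"
    by (rule mat_2x2_eqI; use mat2_carrier mult_carrier_mat[OF mat2_carrier mat2_carrier] in
        \<open>simp add: mult_2x2_index[of _ _ 0] mult_2x2_index[of _ _ "Suc 0"]\<close>)
  then show ?thesis using assms
    by (simp add: times_psl.abs_eq psl_rel_def det_mat2 mat2_carrier)
qed

lemma Proj_letter_rels:
  "Proj_letter F * Proj_letter L = Proj_letter N * Proj_letter F"
  "Proj_letter F * Proj_letter N = Proj_letter L * Proj_letter F"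
  "Proj_letter F * Proj_letter F = 1"
proof -
  have "1\<^sub>m 2 = mat2 1 0 0 1"
    by (rule mat_2x2_eqI; use mat2_carrier in simp)
  then show "Proj_letter F * Proj_letter F = 1"
    by (simp add: psl_of_mat2_mult one_psl_def)
qed (simp_all add: psl_of_mat2_mult)

lift_definition Proj :: "sigma \<Rightarrow> psl" is "\<lambda>w. prod_list (map Proj_letter w)"
proof -
  fix u v assume "equivclp sigma_step u v"
  then show "prod_list (map Proj_letter u) = prod_list (map Proj_letter v)"
  proof (induction rule: equivclp_induct)
    case base then show ?case by simp
  next
    case (step v w)
    have *: "prod_list (map Proj_letter a) = prod_list (map Proj_letter b)"
      if "sigma_step a b" for a b
      using that
    proof cases
      case (FL u v)
      have "prod_list (map Proj_letter [F, L]) = prod_list (map Proj_letter [N, F])"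
        by (simp only: list.map prod_list.Cons prod_list.Nil mult_1_right Proj_letter_rels)
      then show ?thesis unfolding FL map_append prod_list.append by (simp only:)
    next
      case (FN u v)
      have "prod_list (map Proj_letter [F, N]) = prod_list (map Proj_letter [L, F])"
        by (simp only: list.map prod_list.Cons prod_list.Nil mult_1_right Proj_letter_rels)
      then show ?thesis unfolding FN map_append prod_list.append by (simp only:)
    next
      case (FF u v)
      have "prod_list (map Proj_letter [F, F]) = 1"
        by (simp only: list.map prod_list.Cons prod_list.Nil mult_1_right Proj_letter_rels)
      then show ?thesis unfolding FF map_append prod_list.append by (simp only: mult_1_left)
    qed
    from step(2) have "sigma_step v w \<or> sigma_step w v" unfolding symclp_def .
    then have "prod_list (map Proj_letter v) = prod_list (map Proj_letter w)"
      by (rule disjE) (rule *, assumption, rule *[symmetric], assumption)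
    with step(3) show ?case by (rule trans)
  qed
qed

datatype p1real = Fin real | Infty

text \<open>Well defined on \<open>psl\<close>, as numerators and denominators change sign simultaneously.\<close>

fun moebius_mat :: "int mat \<Rightarrow> p1real \<Rightarrow> p1real" where
  "moebius_mat A (Fin x) =
     (let p = real_of_int (A $$ (0,0)) * x + real_of_int (A $$ (0,1));
          q = real_of_int (A $$ (1,0)) * x + real_of_int (A $$ (1,1))
      in if q = 0 then Infty else Fin (p / q))"
| "moebius_mat A Infty =
     (if A $$ (1,0) = 0 then Infty
      else Fin (real_of_int (A $$ (0,0)) / real_of_int (A $$ (1,0))))"

lift_definition moebius :: "psl \<Rightarrow> p1real \<Rightarrow> p1real" is moebius_mat
proof -
  fix A A' assume "psl_rel A A'"
  then have A: "A \<in> carrier_mat 2 2" and A': "A' = A \<or> A' = - A"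
    by (auto simp: psl_rel_def)
  have "moebius_mat (- A) x = moebius_mat A x" for x
  proof (cases x)
    case (Fin y)
    have "real_of_int ((- A) $$ (i,0)) * y + real_of_int ((- A) $$ (i,1)) =
        - (real_of_int (A $$ (i,0)) * y + real_of_int (A $$ (i,1)))" if "i < 2" for i
      using A that by simp
    from this[of 0] this[of 1] show ?thesis unfolding Fin moebius_mat.simps Let_def
      by (simp only: minus_divide_divide neg_equal_0_iff_equal)
  next
    case Infty
    then show ?thesis using A by simp
  qed
  with A' show "moebius_mat A = moebius_mat A'" by auto
qed

text \<open>Unimodular intervals correspond bijectively to the elements of \<^const>\<open>PSL2Z\<close>, and a
  system of intervals is given as a function \<open>I\<close> from nodes to \<^const>\<open>PSL2Z\<close>;
  \<open>ivl (I i)\<close>, the image of \<open>[0, \<infinity>]\<close>, is the interval as a point set.\<close>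

definition ivl :: "psl \<Rightarrow> p1real set" where
  "ivl g = moebius g ` ({Fin x | x. x \<ge> 0} \<union> {Infty})"

section \<open>The graph-directed iterated function system\<close>

definition B_edge :: "(nat \<Rightarrow> psl) \<Rightarrow> edge \<Rightarrow> psl" where
  "B_edge I a = I (src a) * Proj (lab a) * psl_inv (I (tgt a))"

definition B_word :: "(nat \<Rightarrow> psl) \<Rightarrow> edge list \<Rightarrow> psl" where
  "B_word I as = prod_list (map (B_edge I) as)"

text \<open>Since \<open>map a [0..<0] = []\<close>, the intersection includes the starting interval itself.\<close>

definition coding_map :: "(nat \<Rightarrow> psl) \<Rightarrow> (nat \<Rightarrow> edge) \<Rightarrow> p1real" where
  "coding_map I a =
     (THE x. x \<in> (\<Inter>t. moebius (B_word I (map a [0..<t])) ` ivl (I (src (a t)))))"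

definition attractor :: "edge set \<Rightarrow> (nat \<Rightarrow> psl) \<Rightarrow> nat \<Rightarrow> p1real set" where
  "attractor A I i = coding_map I ` E_omega A i"

definition fiber :: "edge set \<Rightarrow> (nat \<Rightarrow> psl) \<Rightarrow> nat \<Rightarrow> p1real \<Rightarrow> (nat \<Rightarrow> edge) set" where
  "fiber A I i x = {a \<in> E_omega A i. coding_map I a = x}"

end

theory Submission
  imports Defs
begin

text \<open>
  After applying \<open>I\<^sub>i\<^sup>-\<^sup>1\<close> to the point \<open>x\<close> under consideration, the intervals of the system no longer matter:
  a path from \<open>i\<close> lies over \<open>x\<close> only if \<open>y = I\<^sub>i\<^sup>-\<^sup>1 x\<close> lies in the cylinder
  \<open>Proj(\<sigma>)[0, \<infinity>]\<close> of the label \<open>\<sigma>\<close> of each of its prefixes. (Labels grow without bound because a loop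
  of length zero would satisfy \<open>\<sigma>\<^sup>3 = \<sigma>\<close>, against the code property; so the cylinders shrink to a point and
  the coding map is well defined.) Cylinders do not see a trailing \<open>f\<close>, and those of words in
  \<open>l, n\<close> are the Stern-Brocot intervals. These overlap only in end points, so for each length at
  most two words have a cylinder containing \<open>y\<close>.

  The bound on fibers is then a pigeonhole argument. Let \<open>D\<close> bound the lengths of the elements of the
  code. Cut every path of the fiber just after its label reaches a large length \<open>k\<close>. The product of
  the prefix is determined by its length in \<open>[k, k + D)\<close>, the choice between at most two words, the presence of
  a final \<open>f\<close>, and the end node: at most \<open>4 D n\<close> values. By the code property the product determines the
  prefix, and if \<open>k\<close> is large then distinct paths have distinct prefixes
  (lemma \<open>card_point_paths\<close>).

  Now let the fiber contain a purely periodic path \<open>a\<close>. After doubling, its period has a label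
  \<open>u\<close> without \<open>f\<close>, and \<open>y\<close> lies in the cylinders of all powers of \<open>u\<close>. Where a point has two
  expansions, these eventually become constant with different letters, and
  each loses a letter which it has used; a periodic expansion cannot do this, so the expansion
  \<open>u\<^sup>\<omega>\<close> of \<open>y\<close> is unique (lemma \<open>periodic_point_unique_word\<close>). Hence the labels of any other path \<open>b\<close> in the fiber
  follow \<open>u\<^sup>\<omega>\<close>. By the pigeonhole principle, \<open>b\<close> has prefixes \<open>b'\<close> and \<open>b''\<close> with the same end node, the same
  final \<open>f\<close> and lengths differing by an arbitrarily large multiple \<open>r \<bar>u\<bar>\<close>. Then \<open>b''\<close> and
  \<open>r\<close> periods of \<open>a\<close> followed by \<open>b'\<close> have equal products, so by the code property \<open>b\<close> begins with \<open>r\<close>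
  periods of \<open>a\<close> (lemma \<open>periodic_point_path_unique\<close>).
\<close>

section \<open>Projective points and the action of the group\<close>

text \<open>The point with homogeneous coordinates \<open>(u : v)\<close>. In these coordinates the action of a matrix is
  linear, which removes the case distinctions at \<open>\<infinity>\<close> from the proof that it is an action.\<close>

definition P1_point :: "real \<Rightarrow> real \<Rightarrow> p1real" where
  "P1_point u v = (if v = 0 then Infty else Fin (u / v))"

lemma P1_point_scale: "r \<noteq> 0 \<Longrightarrow> P1_point (r * u) (r * v) = P1_point u v"
  by (simp add: P1_point_def)

lemma P1_point_cases:
  obtains u v where "x = P1_point u v" "u \<noteq> 0 \<or> v \<noteq> 0"
proof (cases x)
  case (Fin r)
  then show ?thesis by (intro that[of r 1]) (auto simp: P1_point_def)
next
  case Infty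
  then show ?thesis by (intro that[of 1 0]) (auto simp: P1_point_def)
qed

lemma psl_rel_mat2: "\<bar>a * d - b * c\<bar> = 1 \<Longrightarrow> psl_rel (mat2 a b c d) (mat2 a b c d)"
  by (simp add: psl_rel_def mat2_carrier det_mat2)

lemma psl_cases:
  obtains a b c d where "g = psl_of_mat (mat2 a b c d)" "\<bar>a * d - b * c\<bar> = 1"
proof (induction g rule: psl.abs_induct)
  case (1 M)
  then have c: "M \<in> carrier_mat 2 2" and d: "\<bar>det M\<bar> = 1" by (auto simp: psl_rel_def)
  have "M = mat2 (M $$ (0,0)) (M $$ (0,1)) (M $$ (1,0)) (M $$ (1,1))"
    by (rule mat_2x2_eqI) (use c mat2_carrier in simp_all)
  moreover have "\<bar>M $$ (0,0) * M $$ (1,1) - M $$ (0,1) * M $$ (1,0)\<bar> = 1"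
    using d det_2x2[OF c] by simp
  ultimately show ?case using 1(2) by metis
qed

lemma moebius_P1_point:
  assumes "\<bar>a * d - b * c\<bar> = 1" "u \<noteq> 0 \<or> v \<noteq> 0"
  shows "moebius (psl_of_mat (mat2 a b c d)) (P1_point u v) = P1_point (a * u + b * v) (c * u + d * v)"
proof (cases "v = 0")
  case True
  then show ?thesis using assms
    by (simp add: moebius.abs_eq[OF psl_rel_mat2] P1_point_def)
next
  case False
  have "real_of_int c * (u / v) + d = (c * u + d * v) / v"
       "real_of_int a * (u / v) + b = (a * u + b * v) / v"
    using False by (simp_all add: field_simps)
  then show ?thesis using assms False
    by (simp add: moebius.abs_eq[OF psl_rel_mat2] P1_point_def Let_def)
qed

lemma unimodular_nonzero:
  fixes u v :: real and a b c d :: int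
  assumes "\<bar>a * d - b * c\<bar> = 1" "u \<noteq> 0 \<or> v \<noteq> 0"
  shows "a * u + b * v \<noteq> 0 \<or> c * u + d * v \<noteq> 0"
proof (rule ccontr)
  assume "\<not> ?thesis"
  then have z: "a * u + b * v = 0" "c * u + d * v = 0" by auto
  have "(a * d - b * c) * u = d * (a * u + b * v) - b * (c * u + d * v)"
       "(a * d - b * c) * v = a * (c * u + d * v) - c * (a * u + b * v)"
    by (simp_all add: algebra_simps)
  then have "real_of_int (a * d - b * c) * u = 0" "real_of_int (a * d - b * c) * v = 0"
    using z by simp_all
  moreover have "real_of_int (a * d - b * c) \<noteq> 0" using assms(1) by (subst of_int_eq_0_iff) auto
  ultimately show False using assms(2) by simp
qed

lemma moebius_mult: "moebius (g * h) x = moebius g (moebius h x)"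
proof -
  obtain a b c d where g: "g = psl_of_mat (mat2 a b c d)" "\<bar>a * d - b * c\<bar> = 1" by (rule psl_cases)
  obtain a' b' c' d' where h: "h = psl_of_mat (mat2 a' b' c' d')" "\<bar>a' * d' - b' * c'\<bar> = 1"
    by (rule psl_cases)
  obtain u v where x: "x = P1_point u v" "u \<noteq> 0 \<or> v \<noteq> 0" by (rule P1_point_cases)
  have "(a * a' + b * c') * (c * b' + d * d') - (a * b' + b * d') * (c * a' + d * c')
      = (a * d - b * c) * (a' * d' - b' * c')"
    by (simp add: algebra_simps)
  then have gh: "\<bar>(a * a' + b * c') * (c * b' + d * d') - (a * b' + b * d') * (c * a' + d * c')\<bar> = 1"
    using g(2) h(2) by (simp add: abs_mult)
  show ?thesis
    unfolding g(1) h(1) psl_of_mat2_mult[OF g(2) h(2)] x(1)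
      moebius_P1_point[OF gh x(2)] moebius_P1_point[OF h(2) x(2)]
      moebius_P1_point[OF g(2) unimodular_nonzero[OF h(2) x(2)]]
    by (simp add: algebra_simps)
qed

lemma moebius_one: "moebius 1 x = x"
proof -
  have "1\<^sub>m 2 = mat2 1 0 0 1"
    by (rule mat_2x2_eqI; use mat2_carrier in simp)
  then have "1 = psl_of_mat (mat2 1 0 0 1)" by (simp add: one_psl_def)
  moreover obtain u v where "x = P1_point u v" "u \<noteq> 0 \<or> v \<noteq> 0" by (rule P1_point_cases)
  ultimately show ?thesis using moebius_P1_point[of 1 1 0 0 u v] by simp
qed

lemma moebius_inv [simp]:
  "moebius (psl_inv g) (moebius g x) = x" "moebius g (moebius (psl_inv g) x) = x"
  by (simp_all add: moebius_mult[symmetric] psl_inv moebius_one)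

lemma moebius_inj [simp]: "moebius g x = moebius g y \<longleftrightarrow> x = y"
  by (metis moebius_inv(1))

section \<open>Cylinders\<close>

definition nonneg_points :: "p1real set" where
  "nonneg_points = {Fin x | x. x \<ge> 0} \<union> {Infty}"

definition cylinder :: "sigma \<Rightarrow> p1real set" where
  "cylinder \<sigma> = moebius (Proj \<sigma>) ` nonneg_points"

lemma Proj_mult: "Proj (\<sigma> * \<tau>) = Proj \<sigma> * Proj \<tau>"
  by transfer simp

lemma Proj_Cons: "Proj (word (x # w)) = Proj_letter x * Proj (word w)"
  by (simp add: Proj.abs_eq)

lemma word_Nil: "word [] = 1"
  by (simp add: one_sigma.abs_eq)

lemma Proj_one: "Proj 1 = 1"
  by (simp add: word_Nil[symmetric] Proj.abs_eq)

lemma cylinder_one: "cylinder 1 = nonneg_points"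
  by (auto simp: cylinder_def Proj_one moebius_one)

lemma moebius_letters:
  "x \<ge> 0 \<Longrightarrow> moebius (Proj_letter L) (Fin x) = Fin (x / (x + 1))"
  "moebius (Proj_letter L) Infty = Fin 1"
  "moebius (Proj_letter N) (Fin x) = Fin (x + 1)"
  "moebius (Proj_letter N) Infty = Infty"
  "moebius (Proj_letter F) (Fin x) = (if x = 0 then Infty else Fin (1 / x))"
  "moebius (Proj_letter F) Infty = Fin 0"
  by (simp_all add: moebius.abs_eq[OF psl_rel_mat2])

declare Proj_letter.simps [simp del]

lemma moebius_letter_nonneg: "moebius (Proj_letter z) ` nonneg_points \<subseteq> nonneg_points"
  by (cases z) (auto simp: nonneg_points_def moebius_letters)

lemma cylinder_word_Cons:
  "cylinder (word (z # w)) = moebius (Proj_letter z) ` cylinder (word w)"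
  by (simp add: cylinder_def Proj_Cons moebius_mult image_image)

lemma cylinder_nonneg: "cylinder \<sigma> \<subseteq> nonneg_points"
proof (induction \<sigma> rule: sigma.abs_induct)
  case (1 w)
  show ?case
  proof (induction w)
    case Nil
    show ?case by (simp add: word_Nil cylinder_one)
  next
    case (Cons z w)
    then show ?case using moebius_letter_nonneg[of z] unfolding cylinder_word_Cons by blast
  qed
qed

lemma cylinder_mult: "cylinder (\<sigma> * \<tau>) = moebius (Proj \<sigma>) ` cylinder \<tau>"
  by (simp add: cylinder_def Proj_mult moebius_mult image_image)

lemma cylinder_mult_subset: "cylinder (\<sigma> * \<tau>) \<subseteq> cylinder \<sigma>"
  unfolding cylinder_mult using cylinder_nonneg[of \<tau>] unfolding cylinder_def by blast

text \<open>The letter \<open>f\<close> acts by \<open>x \<mapsto> 1/x\<close>, which maps \<open>[0, \<infinity>]\<close> onto itself. This is why a fiber is governed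
  by words in \<open>l, n\<close> only.\<close>

lemma cylinder_F: "cylinder (\<sigma> * word [F]) = cylinder \<sigma>"
proof -
  have "moebius (Proj_letter F) ` nonneg_points = nonneg_points" (is "?f ` _ = _")
  proof
    show "?f ` nonneg_points \<subseteq> nonneg_points" by (rule moebius_letter_nonneg)
    then have "?f ` ?f ` nonneg_points \<subseteq> ?f ` nonneg_points" by blast
    then show "nonneg_points \<subseteq> ?f ` nonneg_points"
      by (simp add: image_image moebius_mult[symmetric] Proj_letter_rels moebius_one)
  qed
  then have "cylinder (word [F]) = nonneg_points"
    by (simp add: cylinder_def Proj.abs_eq)
  then show ?thesis by (simp add: cylinder_mult) (simp add: cylinder_def)
qed

definition flips :: "bool \<Rightarrow> sigma" where
  "flips e = (if e then word [F] else 1)"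

lemma cylinder_flips: "cylinder (\<sigma> * flips e) = cylinder \<sigma>"
  by (simp add: flips_def cylinder_F)

lemma sigma_normal_form_flips:
  obtains w e where "set w \<subseteq> {L, N}" "\<sigma> = word w * flips e"
proof -
  obtain w where "set w \<subseteq> {L, N}" "\<sigma> = word w \<or> \<sigma> = word w * word [F]"
    using sigma_normal_form by blast
  then show ?thesis using that[of w True] that[of w False] by (auto simp: flips_def)
qed

lemma sigma_length_mult: "sigma_length (\<sigma> * \<tau>) = sigma_length \<sigma> + sigma_length \<tau>"
  by (induction \<sigma> rule: sigma.abs_induct, induction \<tau> rule: sigma.abs_induct)
    (simp add: word_mult sigma_length_word)

lemma sigma_length_one: "sigma_length 1 = 0"
  by (simp add: word_Nil[symmetric] sigma_length_word)

lemma sigma_length_normal_form: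
  assumes "set w \<subseteq> {L, N}"
  shows "sigma_length (word w * flips e) = length w"
proof -
  have "filter (\<lambda>x. x \<noteq> F) w = w" using assms by (auto intro!: filter_True)
  then show ?thesis
    by (auto simp: flips_def sigma_length_mult sigma_length_one sigma_length_word)
qed

section \<open>Cylinders shrink\<close>

text \<open>A chart identifying \<open>[0, 1]\<close> with \<open>[0, \<infinity>]\<close>, inverse to \<open>x \<mapsto> x / (1 + x)\<close>. It makes
  cylinders compact intervals of reals, with lengths that also control the ones ending at \<open>\<infinity>\<close>.\<close>

definition farey_point :: "real \<Rightarrow> p1real" where
  "farey_point s = P1_point s (1 - s)"

lemma farey_point_inj: "farey_point s = farey_point t \<longleftrightarrow> s = t"
proof -
  have "s = t" if "s / (1 - s) = t / (1 - t)" "s \<noteq> 1" "t \<noteq> 1"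
    using that by (simp add: field_simps)
  then show ?thesis by (auto simp: farey_point_def P1_point_def split: if_splits)
qed

lemma nonneg_points_farey: "nonneg_points = farey_point ` {0..1}"
proof
  show "nonneg_points \<subseteq> farey_point ` {0..1}"
  proof
    fix y assume "y \<in> nonneg_points"
    then consider x where "y = Fin x" "x \<ge> 0" | "y = Infty" by (auto simp: nonneg_points_def)
    then show "y \<in> farey_point ` {0..1}"
    proof cases
      case 1
      then have "1 - x / (1 + x) = 1 / (1 + x)" by (simp add: field_simps)
      then have "y = farey_point (x / (1 + x))"
        using 1 by (simp add: farey_point_def P1_point_def)
      then show ?thesis using 1(2) by simp
    next
      case 2
      then have "y = farey_point 1" by (simp add: farey_point_def P1_point_def)
      then show ?thesis by simp
    qed
  qed
qed (auto simp: nonneg_points_def farey_point_def P1_point_def)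

lemma P1_point_farey:
  assumes "u + v \<noteq> 0"
  shows "P1_point u v = farey_point (u / (u + v))"
proof -
  have "1 - u / (u + v) = v / (u + v)" using assms by (simp add: field_simps)
  then show ?thesis using assms P1_point_scale[of "1 / (u + v)" u v] by (simp add: farey_point_def)
qed

text \<open>Multiplication on the right by a letter adds one column of the matrix to the other one, and
  every column sum is at least 1; so the sum of the entries grows by at least 1 per letter.\<close>

lemma Proj_word_matrix:
  assumes "set w \<subseteq> {L, N}"
  shows "\<exists>a b c d. Proj (word w) = psl_of_mat (mat2 a b c d) \<and> a * d - b * c = 1 \<and>
    a + c \<ge> 1 \<and> b + d \<ge> 1 \<and>
    a + b + c + d \<ge> int (length w) + 2"
  using assms
proof (induction w rule: rev_induct)
  case Nil
  have "1\<^sub>m 2 = mat2 1 0 0 1"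
    by (rule mat_2x2_eqI; use mat2_carrier in simp)
  then have "Proj (word []) = psl_of_mat (mat2 1 0 0 1)"
    by (simp add: word_Nil Proj_one one_psl_def)
  then show ?case by (intro exI[of _ 1] exI[of _ 0] exI[of _ 0] exI[of _ 1]) simp
next
  case (snoc z w)
  then obtain a b c d where w: "Proj (word w) = psl_of_mat (mat2 a b c d)" "a * d - b * c = 1"
    "a + c \<ge> 1" "b + d \<ge> 1" "a + b + c + d \<ge> int (length w) + 2"
    by auto
  have P: "Proj (word (w @ [z])) = psl_of_mat (mat2 a b c d) * Proj_letter z"
    by (simp add: word_mult[symmetric] Proj_mult w(1) Proj.abs_eq[of "[z]"])
  from snoc.prems have "z = L \<or> z = N" by auto
  then show ?case
  proof
    assume "z = L"
    then have "Proj (word (w @ [z])) = psl_of_mat (mat2 (a + b) b (c + d) d)"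
      unfolding P using w(2) by (simp add: psl_of_mat2_mult Proj_letter.simps)
    moreover have "(a + b) * d - b * (c + d) = 1" using w(2) by (simp add: algebra_simps)
    ultimately show ?thesis using w(3-)
      by (intro exI[of _ "a + b"] exI[of _ b] exI[of _ "c + d"] exI[of _ d]) simp
  next
    assume "z = N"
    then have "Proj (word (w @ [z])) = psl_of_mat (mat2 a (a + b) c (c + d))"
      unfolding P using w(2) by (simp add: psl_of_mat2_mult Proj_letter.simps)
    moreover have "a * (c + d) - (a + b) * c = 1" using w(2) by (simp add: algebra_simps)
    ultimately show ?thesis using w(3-)
      by (intro exI[of _ a] exI[of _ "a + b"] exI[of _ c] exI[of _ "c + d"]) simp
  qed
qed

text \<open>In the chart, the columns of the matrix become the end points of the image interval. The column sums
  \<open>p = a + c\<close> and \<open>q = b + d\<close> are the denominators there, and determinant 1 turns into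
  \<open>a q - b p = 1\<close>, so that the interval has length \<open>1 / (p q)\<close>.\<close>

lemma moebius_nonneg_points_farey:
  fixes a b c d :: int
  assumes det: "a * d - b * c = 1" and pq: "a + c \<ge> 1" "b + d \<ge> 1"
  shows "moebius (psl_of_mat (mat2 a b c d)) ` nonneg_points =
    farey_point ` {b / real_of_int (b + d) .. a / real_of_int (a + c)}" (is "?M ` _ = farey_point ` {?l..?r}")
proof -
  define p q where "p = real_of_int (a + c)" and "q = real_of_int (b + d)"
  have p: "p \<ge> 1" and q: "q \<ge> 1" using pq by (simp_all add: p_def q_def)
  have "real_of_int a * q - b * p = real_of_int (a * d - b * c)"
    unfolding p_def q_def by (simp add: algebra_simps)
  then have aqbp: "real_of_int a * q - b * p = 1" using det by simp
  have det': "\<bar>a * d - b * c\<bar> = 1" using det by simp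
  have D: "p * t + q * (1 - t) > 0" if "t \<in> {0..1}" for t :: real
  proof (cases "t = 0")
    case False
    then show ?thesis using that p q by (intro add_pos_nonneg) auto
  qed (use q in simp)
  have image: "?M (farey_point t) = farey_point ((a * t + b * (1 - t)) / (p * t + q * (1 - t)))"
    if "t \<in> {0..1}" for t :: real
  proof -
    have "(a * t + b * (1 - t)) + (c * t + d * (1 - t)) = p * t + q * (1 - t)"
      by (simp add: p_def q_def algebra_simps)
    then show ?thesis using D[OF that]
      unfolding farey_point_def[of t]
      by (subst moebius_P1_point[OF det']) (auto simp: P1_point_farey)
  qed
  have "?M (farey_point t) \<in> farey_point ` {?l..?r}" if t: "t \<in> {0..1}" for t :: real
  proof -
    have "(a * t + b * (1 - t)) * q - b * (p * t + q * (1 - t)) = t * (a * q - b * p)"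
         "a * (p * t + q * (1 - t)) - (a * t + b * (1 - t)) * p = (1 - t) * (a * q - b * p)"
      by (simp_all add: algebra_simps)
    then have "(a * t + b * (1 - t)) * q \<ge> b * (p * t + q * (1 - t))"
      "a * (p * t + q * (1 - t)) \<ge> (a * t + b * (1 - t)) * p"
      using t aqbp by simp_all
    then have "(a * t + b * (1 - t)) / (p * t + q * (1 - t)) \<in> {b / q..a / p}"
      using D[OF t] p q by (simp add: divide_simps mult.commute)
    then show ?thesis using image[OF t] by (simp add: p_def q_def)
  qed
  moreover have "farey_point s \<in> ?M ` farey_point ` {0..1}" if "s \<in> {?l..?r}" for s
  proof -
    from that have "b \<le> q * s" "p * s \<le> a" using p q
      by (simp_all add: p_def q_def divide_simps mult.commute)
    \<comment> \<open>the inverse matrix applied to \<open>(s, 1 - s)\<close>\<close>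
    define u v where "u = q * s - b" and "v = a - p * s"
    have uv: "u \<ge> 0" "v \<ge> 0" using \<open>b \<le> q * s\<close> \<open>p * s \<le> a\<close> by (simp_all add: u_def v_def)
    have s: "a * u + b * v = s"
    proof -
      have "a * u + b * v = (a * q - b * p) * s" by (simp add: u_def v_def algebra_simps)
      then show ?thesis using aqbp by simp
    qed
    have "c * u + d * v = 1 - s"
    proof -
      have "(a * u + b * v) + (c * u + d * v) = p * u + q * v"
        by (simp add: p_def q_def algebra_simps)
      also have "\<dots> = a * q - b * p" by (simp add: u_def v_def algebra_simps)
      finally show ?thesis using aqbp s by simp
    qed
    with s have "u \<noteq> 0 \<or> v \<noteq> 0" by (cases "u = 0") auto
    then have "?M (P1_point u v) = farey_point s"
      using s \<open>c * u + d * v = 1 - s\<close> by (simp add: moebius_P1_point[OF det'] farey_point_def)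
    moreover have "P1_point u v = farey_point (u / (u + v))"
      using uv \<open>u \<noteq> 0 \<or> v \<noteq> 0\<close> by (intro P1_point_farey) auto
    moreover have "u / (u + v) \<in> {0..1}" using uv by (auto simp: divide_simps)
    ultimately show ?thesis by (metis imageI)
  qed
  ultimately show ?thesis unfolding nonneg_points_farey by blast
qed

text \<open>Since \<open>p, q \<ge> 1\<close>, we have \<open>p q \<ge> p + q - 1\<close>, and \<open>p + q\<close> grows with the length.\<close>

lemma cylinder_farey_interval:
  "\<exists>l r. l \<le> r \<and> r - l \<le> 1 / (sigma_length \<sigma> + 1) \<and> cylinder \<sigma> = farey_point ` {l..r}"
proof -
  obtain w e where w: "set w \<subseteq> {L, N}" "\<sigma> = word w * flips e" by (rule sigma_normal_form_flips)
  obtain a b c d where M: "Proj (word w) = psl_of_mat (mat2 a b c d)" "a * d - b * c = 1"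
    "a + c \<ge> 1" "b + d \<ge> 1" "a + b + c + d \<ge> int (length w) + 2"
    using Proj_word_matrix[OF w(1)] by blast
  define p q where "p = a + c" and "q = b + d"
  have pq: "p \<ge> 1" "q \<ge> 1" "p + q \<ge> int (length w) + 2" using M by (simp_all add: p_def q_def)
  have "a * q - b * p = 1" using M(2) by (simp add: p_def q_def algebra_simps)
  then have "real_of_int (a * q - b * p) = 1" by (simp only: of_int_1)
  then have aqbp: "real_of_int a * q - b * p = 1" by (simp only: of_int_diff of_int_mult)
  have "(p - 1) * (q - 1) \<ge> 0" using pq by simp
  then have "int (length w) + 1 \<le> p * q" using pq(3) by (simp add: algebra_simps)
  then have "real_of_int (int (length w) + 1) \<le> real_of_int (p * q)" by (simp only: of_int_le_iff)
  then have pql: "real (length w) + 1 \<le> real_of_int p * q" by simp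
  have width: "real_of_int a / p - b / q = 1 / (real_of_int p * q)"
    using aqbp pq by (simp add: divide_simps)
  have "cylinder \<sigma> = farey_point ` {b / real_of_int q .. a / real_of_int p}"
    unfolding w(2) cylinder_flips unfolding cylinder_def M(1) p_def q_def
    using M(2-4) by (rule moebius_nonneg_points_farey)
  moreover have "1 / (real_of_int p * q) \<le> 1 / (sigma_length \<sigma> + 1)"
    unfolding w(2) sigma_length_normal_form[OF w(1)] using pql by (intro frac_le) auto
  moreover have "1 / (real_of_int p * q) \<ge> 0" using pq by simp
  ultimately have "b / real_of_int q \<le> a / real_of_int p \<and>
      a / real_of_int p - b / real_of_int q \<le> 1 / (sigma_length \<sigma> + 1) \<and>
      cylinder \<sigma> = farey_point ` {b / real_of_int q .. a / real_of_int p}"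
    using width by (intro conjI) linarith+
  then show ?thesis by blast
qed

lemma cylinders_unique_point:
  assumes unbounded: "\<And>k. \<exists>t. k \<le> sigma_length (\<tau> t)"
    and chain: "\<And>t. \<exists>\<sigma>. \<tau> (Suc t) = \<tau> t * \<sigma>"
  shows "\<exists>!y. \<forall>t. y \<in> cylinder (\<tau> t)"
proof -
  have "\<forall>t. \<exists>l r. l \<le> r \<and> r - l \<le> 1 / (sigma_length (\<tau> t) + 1) \<and> cylinder (\<tau> t) = farey_point ` {l..r}"
    using cylinder_farey_interval by blast
  then obtain l r where lr: "\<And>t. l t \<le> r t" "\<And>t. r t - l t \<le> 1 / (sigma_length (\<tau> t) + 1)"
    "\<And>t. cylinder (\<tau> t) = farey_point ` {l t..r t}" by metis
  have len_mono: "sigma_length (\<tau> s) \<le> sigma_length (\<tau> t)" if "s \<le> t" for s t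
    using that
  proof (induction rule: dec_induct)
    case (step t)
    from chain[of t] show ?case using step(3) by (auto simp: sigma_length_mult)
  qed simp
  have nested: "{l (Suc t)..r (Suc t)} \<subseteq> {l t..r t}" for t
  proof -
    have "cylinder (\<tau> (Suc t)) \<subseteq> cylinder (\<tau> t)"
      by (metis chain cylinder_mult_subset)
    moreover have "inj farey_point" by (simp add: inj_on_def farey_point_inj)
    ultimately show ?thesis unfolding lr(3) by (simp only: inj_image_subset_iff)
  qed
  have width: "(\<lambda>t. r t - l t) \<longlonglongrightarrow> 0"
  proof (rule LIMSEQ_I)
    fix e :: real assume "e > 0"
    then obtain k :: nat where k: "1 / e < real k" using reals_Archimedean2 by blast
    obtain T where T: "k \<le> sigma_length (\<tau> T)" using unbounded by blast
    have "norm (r t - l t - 0) < e" if "t \<ge> T" for t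
    proof -
      have "real k \<le> sigma_length (\<tau> t)" using T len_mono[OF that] by simp
      then have "1 / e < sigma_length (\<tau> t) + 1" using k by linarith
      then have "1 / (sigma_length (\<tau> t) + 1) < e" using \<open>e > 0\<close> by (simp add: field_simps)
      then show ?thesis using lr(1)[of t] lr(2)[of t] by simp
    qed
    then show "\<exists>T. \<forall>t\<ge>T. norm (r t - l t - 0) < e" by blast
  qed
  have "(\<lambda>t. l t - r t) \<longlonglongrightarrow> 0" using tendsto_minus[OF width] by simp
  moreover have "l t \<le> l (Suc t) \<and> r (Suc t) \<le> r t" for t
    using nested[of t] lr(1)[of "Suc t"] by simp
  ultimately obtain m where m: "\<And>t. l t \<le> m" "l \<longlonglongrightarrow> m" "\<And>t. m \<le> r t" "r \<longlonglongrightarrow> m"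
    using nested_sequence_unique[of l r] lr(1) by blast
  show ?thesis
  proof (rule ex1I)
    show "\<forall>t. farey_point m \<in> cylinder (\<tau> t)" using m(1,3) by (auto simp: lr(3))
  next
    fix y assume y: "\<forall>t. y \<in> cylinder (\<tau> t)"
    then obtain s where s: "y = farey_point s" by (auto simp: lr(3))
    with y have "l t \<le> s" "s \<le> r t" for t by (auto simp: lr(3) farey_point_inj)
    then have "s = m"
      using LIMSEQ_le_const2[OF m(2), of s] LIMSEQ_le_const[OF m(4), of s] by (simp add: antisym)
    then show "y = farey_point m" by (simp add: s)
  qed
qed

section \<open>Words of a given point\<close>

definition point_words :: "nat \<Rightarrow> p1real \<Rightarrow> letter list set" where
  "point_words m y = {v. length v = m \<and> set v \<subseteq> {L, N} \<and> y \<in> cylinder (word v)}"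

lemma nonneg_points_cases:
  assumes "y \<in> nonneg_points"
  obtains x where "y = Fin x" "x \<ge> 0" | "y = Infty"
  using assms by (auto simp: nonneg_points_def)

lemma Infty_cylinder_Cons:
  assumes "Infty \<in> cylinder (word (z # w))" "z \<in> {L, N}"
  shows "z = N \<and> Infty \<in> cylinder (word w)"
proof -
  obtain y where y: "y \<in> cylinder (word w)" "Infty = moebius (Proj_letter z) y"
    using assms(1) unfolding cylinder_word_Cons by blast
  then show ?thesis using assms(2) cylinder_nonneg[of "word w"]
    by (elim nonneg_points_cases[OF subsetD])
      (auto simp: moebius_letters)
qed

lemma zero_cylinder_Cons:
  assumes "Fin 0 \<in> cylinder (word (z # w))" "z \<in> {L, N}"
  shows "z = L \<and> Fin 0 \<in> cylinder (word w)"
proof -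
  obtain y where y: "y \<in> cylinder (word w)" "Fin 0 = moebius (Proj_letter z) y"
    using assms(1) unfolding cylinder_word_Cons by blast
  then show ?thesis using assms(2) cylinder_nonneg[of "word w"]
    by (elim nonneg_points_cases[OF subsetD])
      (auto simp: moebius_letters)
qed

text \<open>The extreme points \<open>\<infinity>\<close> and \<open>0\<close> have a single expansion each, fixed by \<open>n\<close> and by \<open>l\<close>.\<close>

lemma Infty_cylinder:
  "Infty \<in> cylinder (word w) \<Longrightarrow> set w \<subseteq> {L, N} \<Longrightarrow> w = replicate (length w) N"
  by (induction w) (auto dest!: Infty_cylinder_Cons)

lemma zero_cylinder:
  "Fin 0 \<in> cylinder (word w) \<Longrightarrow> set w \<subseteq> {L, N} \<Longrightarrow> w = replicate (length w) L"
  by (induction w) (auto dest!: zero_cylinder_Cons)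

text \<open>The letters \<open>l\<close> and \<open>n\<close> map \<open>[0, \<infinity>]\<close> onto \<open>[0, 1]\<close> and \<open>[1, \<infinity>]\<close>, so expansions of a point can
  branch only at \<open>1 = l(\<infinity>) = n(0)\<close>.\<close>

lemma cylinder_L_inter_N:
  assumes "y \<in> cylinder (word (L # v))" "y \<in> cylinder (word (N # w))"
  shows "y = Fin 1 \<and> Infty \<in> cylinder (word v) \<and> Fin 0 \<in> cylinder (word w)"
proof -
  obtain y1 where y1: "y1 \<in> cylinder (word v)" "y = moebius (Proj_letter L) y1"
    using assms(1) unfolding cylinder_word_Cons by blast
  obtain y2 where y2: "y2 \<in> cylinder (word w)" "y = moebius (Proj_letter N) y2"
    using assms(2) unfolding cylinder_word_Cons by blast
  have nonneg: "y1 \<in> nonneg_points" "y2 \<in> nonneg_points" using y1(1) y2(1) cylinder_nonneg by blast+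
  have small: "x / (x + 1) < 1" if "x \<ge> 0" for x :: real
    using that by simp
  have "y1 = Infty"
  proof (rule nonneg_points_cases[OF nonneg(1)])
    fix x1 assume x1: "y1 = Fin x1" "x1 \<ge> 0"
    show ?thesis
    proof (rule nonneg_points_cases[OF nonneg(2)])
      fix x2 assume x2: "y2 = Fin x2" "x2 \<ge> 0"
      then have "x1 / (x1 + 1) = x2 + 1" using x1 y1(2) y2(2) by (simp only: moebius_letters p1real.inject)
      then show ?thesis using small[OF x1(2)] x2(2) by linarith
    next
      assume "y2 = Infty"
      then show ?thesis using x1 y1(2) y2(2) by (simp only: moebius_letters p1real.distinct)
    qed
  qed
  then have y: "y = Fin 1" using y1(2) by (simp only: moebius_letters)
  have "y2 = Fin 0"
  proof (rule nonneg_points_cases[OF nonneg(2)])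
    fix x2 assume x2: "y2 = Fin x2" "x2 \<ge> 0"
    then show ?thesis using y y2(2) by (simp add: moebius_letters)
  next
    assume "y2 = Infty"
    then show ?thesis using y y2(2) by (simp only: moebius_letters p1real.distinct)
  qed
  then show ?thesis using y \<open>y1 = Infty\<close> y1(1) y2(1) by simp
qed

lemma point_words_Suc:
  "point_words (Suc m) y = (\<Union>z\<in>{L, N}. (#) z ` point_words m (moebius (psl_inv (Proj_letter z)) y))"
proof -
  have "y \<in> cylinder (word (z # w)) \<longleftrightarrow> moebius (psl_inv (Proj_letter z)) y \<in> cylinder (word w)" for z w
    unfolding cylinder_word_Cons by (force)
  then show ?thesis
    by (auto simp: point_words_def length_Suc_conv)
qed

lemma finite_point_words: "finite (point_words m y)"
  by (rule finite_subset[OF _ finite_lists_length_eq[of "{L, N}" m]]) (auto simp: point_words_def)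

text \<open>Without branching at the first letter, the count is that of another point. With branching,
  both continuations are forced, by the expansions of \<open>\<infinity>\<close> and \<open>0\<close>.\<close>

lemma card_point_words: "card (point_words m y) \<le> 2"
proof (induction m arbitrary: y)
  case 0
  have "point_words 0 y \<subseteq> {[]}" by (auto simp: point_words_def)
  then have "card (point_words 0 y) \<le> card {[] :: letter list}" by (intro card_mono) auto
  then show ?case by simp
next
  case (Suc m)
  let ?P = "\<lambda>z. (#) z ` point_words m (moebius (psl_inv (Proj_letter z)) y)"
  have P: "card (?P z) \<le> 2" for z
    using card_image_le[OF finite_point_words, of "(#) z" m] Suc.IH by (rule order_trans)
  consider "?P L = {}" | "?P N = {}" | v w where "L # v \<in> ?P L" "N # w \<in> ?P N" by blast
  then show ?case
  proof cases
    case 1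
    then have "point_words (Suc m) y = ?P N" unfolding point_words_Suc by blast
    then show ?thesis using P by metis
  next
    case 2
    then have "point_words (Suc m) y = ?P L" unfolding point_words_Suc by blast
    then show ?thesis using P by metis
  next
    case 3
    then have vw: "L # v \<in> point_words (Suc m) y" "N # w \<in> point_words (Suc m) y"
      unfolding point_words_Suc by blast+
    have "point_words (Suc m) y \<subseteq> {L # replicate m N, N # replicate m L}"
    proof
      fix u assume u: "u \<in> point_words (Suc m) y"
      then obtain z u' where zu: "u = z # u'" "length u' = m" "set u' \<subseteq> {L, N}" "z \<in> {L, N}"
        by (auto simp: point_words_def length_Suc_conv)
      have "u' = replicate m N" if "z = L"
        using cylinder_L_inter_N[of y u' w] u vw zu that Infty_cylinder[of u']
        by (auto simp: point_words_def)
      moreover have "u' = replicate m L" if "z = N"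
        using cylinder_L_inter_N[of y v u'] u vw zu that zero_cylinder[of u']
        by (auto simp: point_words_def)
      ultimately show "u \<in> {L # replicate m N, N # replicate m L}" using zu by auto
    qed
    then have "card (point_words (Suc m) y) \<le> card {L # replicate m N, N # replicate m L}"
      by (intro card_mono) auto
    then show ?thesis by simp
  qed
qed

text \<open>At the first difference between \<open>v\<close> and \<open>v'\<close> the remaining point is 1; if \<open>v\<close> continues there
  with \<open>x\<close>, all its later letters are the other letter. Such a letter \<open>x\<close> serves as the witness.\<close>

lemma two_words_lose_letter:
  assumes "y \<in> cylinder (word v)" "y \<in> cylinder (word v')" "length v = length v'" "v \<noteq> v'"
    "set v \<subseteq> {L, N}" "set v' \<subseteq> {L, N}"
  shows "\<exists>x\<in>set v. \<forall>r. set r \<subseteq> {L, N} \<longrightarrow> y \<in> cylinder (word (v @ r)) \<longrightarrow> x \<notin> set r"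
  using assms
proof (induction v arbitrary: v' y)
  case (Cons z v)
  then obtain z' u where v': "v' = z' # u" "length u = length v" by (cases v') auto
  have zz: "z \<in> {L, N}" "z' \<in> {L, N}" using Cons.prems v' by auto
  show ?case
  proof (cases "z = z'")
    case True
    from Cons.prems(1) obtain y0 where y0: "y0 \<in> cylinder (word v)" "y = moebius (Proj_letter z) y0"
      unfolding cylinder_word_Cons by blast
    have strip: "y \<in> cylinder (word (z # w)) \<Longrightarrow> y0 \<in> cylinder (word w)" for w
      unfolding cylinder_word_Cons y0(2) by (auto)
    have "y0 \<in> cylinder (word u)" using Cons.prems(2) v' True strip by simp
    then have "\<exists>x\<in>set v. \<forall>r. set r \<subseteq> {L, N} \<longrightarrow> y0 \<in> cylinder (word (v @ r)) \<longrightarrow> x \<notin> set r"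
      using Cons.IH[of y0 u] Cons.prems y0(1) v' True by auto
    then show ?thesis using strip by (metis append_Cons list.set_intros(2))
  next
    case False
    show ?thesis
    proof (intro bexI[of _ z] allI impI)
      fix r assume r: "set r \<subseteq> {L, N}" "y \<in> cylinder (word ((z # v) @ r))"
      have vr: "set (v @ r) \<subseteq> {L, N}" using Cons.prems r by auto
      from zz False consider "z = L" "z' = N" | "z = N" "z' = L" by auto
      then show "z \<notin> set r"
      proof cases
        case 1
        then have "Infty \<in> cylinder (word (v @ r))"
          using cylinder_L_inter_N[of y "v @ r" u] r Cons.prems(2) v' by simp
        from Infty_cylinder[OF this vr] have "set (v @ r) \<subseteq> {N}"
          by (metis set_replicate_conv_if empty_subsetI order_refl)
        then show ?thesis using 1 by auto
      next
        case 2
        then have "Fin 0 \<in> cylinder (word (v @ r))"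
          using cylinder_L_inter_N[of y u "v @ r"] r Cons.prems(2) v' by simp
        from zero_cylinder[OF this vr] have "set (v @ r) \<subseteq> {L}"
          by (metis set_replicate_conv_if empty_subsetI order_refl)
        then show ?thesis using 2 by auto
      qed
    qed simp
  qed
qed simp

definition word_power :: "nat \<Rightarrow> 'a list \<Rightarrow> 'a list" where
  "word_power q u = concat (replicate q u)"

lemma word_power_simps [simp]:
  "word_power 0 u = []" "word_power (Suc q) u = u @ word_power q u"
  "length (word_power q u) = q * length u"
  by (simp_all add: word_power_def) (induction q; simp)

lemma word_power_add: "word_power (q + q') u = word_power q u @ word_power q' u"
  by (simp add: word_power_def replicate_add)

lemma set_word_power: "set (word_power q u) \<subseteq> set u"
  by (auto simp: word_power_def)

lemma word_word_power: "word (word_power q u) = word u ^ q"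
  by (induction q) (simp_all add: word_Nil word_mult[symmetric])

text \<open>If \<open>v\<close> differed from the initial piece \<open>h\<close> of the power of \<open>u\<close>, then some letter of \<open>h\<close>, hence of \<open>u\<close>,
  would be absent from every continuation of \<open>h\<close> in the expansion. But continuations contain full copies of \<open>u\<close>.\<close>

lemma periodic_point_unique_word:
  assumes u: "set u \<subseteq> {L, N}" and y: "\<And>q. y \<in> cylinder (word (word_power q u))"
    and v: "set v \<subseteq> {L, N}" "y \<in> cylinder (word v)" "length v \<le> q * length u"
  shows "v = take (length v) (word_power q u)"
proof (rule ccontr)
  define h where "h = take (length v) (word_power q u)"
  define r where "r = drop (length v) (word_power q u) @ u"
  assume "\<not> ?thesis"
  then have "v \<noteq> h" by (simp add: h_def)
  have "word_power 1 u = u" by (simp add: word_power_def)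
  then have hr: "h @ r = word_power (q + 1) u" unfolding word_power_add by (simp add: h_def r_def)
  have LN: "set h \<subseteq> set u" "set r \<subseteq> set u"
    using set_word_power[of q u] unfolding h_def r_def
    by (auto dest: in_set_takeD in_set_dropD)
  have yhr: "y \<in> cylinder (word (h @ r))" unfolding hr by (rule y)
  then have "y \<in> cylinder (word h)"
    using cylinder_mult_subset unfolding word_mult[symmetric] by blast
  then obtain x where x: "x \<in> set h" "\<And>r. set r \<subseteq> {L, N} \<Longrightarrow> y \<in> cylinder (word (h @ r)) \<Longrightarrow> x \<notin> set r"
    using two_words_lose_letter[of y h v] v LN u \<open>v \<noteq> h\<close> by (auto simp: h_def)
  have "x \<notin> set r" using x(2)[OF _ yhr] LN u by blast
  moreover have "x \<in> set r" using x(1) LN by (auto simp: r_def)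
  ultimately show False by contradiction
qed

section \<open>Paths in the graph of a code\<close>

definition segment_label :: "(nat \<Rightarrow> edge) \<Rightarrow> nat \<Rightarrow> nat \<Rightarrow> sigma" where
  "segment_label a s t = prod_list (map (\<lambda>k. lab (a k)) [s..<t])"

lemma segment_label_same [simp]: "segment_label a s s = 1"
  by (simp add: segment_label_def)

lemma segment_label_split:
  "s \<le> t \<Longrightarrow> t \<le> t' \<Longrightarrow> segment_label a s t' = segment_label a s t * segment_label a t t'"
  using upt_add_eq_append[of s t "t' - t"] by (simp add: segment_label_def)

lemma segment_label_Suc: "s \<le> t \<Longrightarrow> segment_label a s (Suc t) = segment_label a s t * lab (a t)"
  by (simp add: segment_label_def)

lemma edge_prod_append:
  assumes "edge_prod as = Some p" "edge_prod bs = Some q" "tgt p = src q"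
  shows "edge_prod (as @ bs) = Some (src p, lab p * lab q, tgt q)"
  using assms(1,3)
proof (induction as arbitrary: p rule: edge_prod.induct)
  case (2 a)
  then show ?case using assms(2)
    by (cases bs) (auto simp: edge_mult_def)
next
  case (3 a b as)
  then show ?case
    by (auto simp: edge_mult_def mult.assoc split: bind_splits if_splits)
qed simp

lemma edge_prod_segment:
  assumes "a \<in> E_omega A i" "s < t"
  shows "edge_prod (map a [s..<t]) = Some (src (a s), segment_label a s t, src (a t))"
proof -
  have adj: "tgt (a k) = src (a (Suc k))" for k using assms(1) by (simp add: E_omega_def)
  have "Suc s \<le> t" using assms(2) by simp
  then show ?thesis
  proof (induction rule: dec_induct)
    case base
    show ?case using adj[of s] by (simp add: segment_label_def) (metis prod.collapse)
  next
    case (step t)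
    have "edge_prod (map a [s..<t] @ [a t]) = Some (src (a s), segment_label a s t * lab (a t), tgt (a t))"
      using edge_prod_append[OF step(3), of "[a t]" "a t"] by simp
    then show ?case using step(1) by (simp add: segment_label_Suc adj)
  qed
qed

lemma E_omega_segment_subset: "a \<in> E_omega A i \<Longrightarrow> set (map a [s..<t]) \<subseteq> A"
  by (auto simp: E_omega_def)

lemma code_unique:
  assumes "is_code n A" "set as \<subseteq> A" "set bs \<subseteq> A" "edge_prod as = Some p" "edge_prod bs = Some p"
  shows "as = bs"
  using assms unfolding is_code_def by (metis option.distinct(1))

lemma word_FF: "word [F] * word [F] = 1"
  using sigma_step.FF[of "[]" "[]"]
  by (auto simp: word_mult sigma.abs_eq_iff one_sigma.abs_eq intro: r_into_equivclp)

text \<open>A loop of length zero has label \<open>1\<close> or \<open>f\<close>, so its third power would have the same product as the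
  loop itself.\<close>

lemma code_loop_positive_length:
  assumes "is_code n A" "set as \<subseteq> A" "edge_prod as = Some (i, \<sigma>, i)"
  shows "sigma_length \<sigma> > 0"
proof (rule ccontr)
  assume zero: "\<not> sigma_length \<sigma> > 0"
  obtain w e where w: "set w \<subseteq> {L, N}" "\<sigma> = word w * flips e" by (rule sigma_normal_form_flips)
  then have "w = []" using zero sigma_length_normal_form by simp
  then have "\<sigma> = flips e" by (simp add: w(2) word_Nil)
  then have "\<sigma> * (\<sigma> * \<sigma>) = \<sigma>" by (simp add: flips_def word_FF)
  moreover have "edge_prod (as @ as @ as) = Some (i, \<sigma> * (\<sigma> * \<sigma>), i)"
    using edge_prod_append[OF assms(3) edge_prod_append[OF assms(3,3)]] by simp
  ultimately have "as @ as @ as = as" using code_unique[OF assms(1), of "as @ as @ as" as] assms by simp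
  then show False using assms(3) by simp
qed

lemma path_node:
  assumes "is_code n A" "a \<in> E_omega A i"
  shows "src (a t) < n"
proof -
  have "a t \<in> edges_over n" using assms unfolding is_code_def E_omega_def by blast
  then show ?thesis by (auto simp: edges_over_def)
qed

text \<open>The path visits some node infinitely often, and its length increases between any two visits.\<close>

lemma path_length_unbounded:
  assumes code: "is_code n A" and a: "a \<in> E_omega A i"
  shows "\<exists>t. k \<le> sigma_length (segment_label a 0 t)"
proof -
  have "range (\<lambda>t. src (a t)) \<subseteq> {..<n}" using path_node[OF code a] by blast
  then have "finite (range (\<lambda>t. src (a t)))" by (rule finite_subset) simp
  then obtain s where "infinite {t \<in> UNIV. src (a t) = src (a s)}"
    using pigeonhole_infinite[of UNIV "\<lambda>t. src (a t)"] by auto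
  then have recur: "\<exists>t'>t. src (a t') = src (a s)" for t
    unfolding infinite_nat_iff_unbounded by blast
  have "\<exists>t. src (a t) = src (a s) \<and> k \<le> sigma_length (segment_label a 0 t)"
  proof (induction k)
    case 0
    show ?case by blast
  next
    case (Suc k)
    then obtain t where t: "src (a t) = src (a s)" "k \<le> sigma_length (segment_label a 0 t)" by blast
    obtain t' where t': "t' > t" "src (a t') = src (a s)" using recur by blast
    have "sigma_length (segment_label a t t') > 0"
      using code_loop_positive_length[OF code E_omega_segment_subset[OF a]] edge_prod_segment[OF a t'(1)]
        t(1) t'(2) by simp
    then have "Suc k \<le> sigma_length (segment_label a 0 t')"
      using t(2) t'(1) segment_label_split[of 0 t t' a] by (simp add: sigma_length_mult)
    then show ?case using t'(2) by blast
  qed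
  then show ?thesis by blast
qed

lemma path_length_le:
  assumes "a \<in> E_omega A i" "\<forall>e\<in>A. sigma_length (lab e) \<le> D"
  shows "sigma_length (segment_label a 0 t) \<le> t * D"
proof (induction t)
  case (Suc t)
  have "sigma_length (lab (a t)) \<le> D" using assms by (simp add: E_omega_def)
  then show ?case using Suc by (simp add: segment_label_Suc sigma_length_mult)
qed (simp add: sigma_length_one)

lemma path_crossing_time:
  assumes "is_code n A" "a \<in> E_omega A i" "\<forall>e\<in>A. sigma_length (lab e) \<le> D" "k \<ge> 1"
  shows "\<exists>t. sigma_length (segment_label a 0 t) \<in> {k..<k + D}"
proof -
  define t where "t = (LEAST t. k \<le> sigma_length (segment_label a 0 t))"
  have k: "k \<le> sigma_length (segment_label a 0 t)"
    unfolding t_def by (rule LeastI_ex) (rule path_length_unbounded[OF assms(1,2)])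
  have "t \<noteq> 0" using k assms(4) by (auto simp: sigma_length_one intro: ccontr)
  then obtain s where s: "t = Suc s" by (cases t) auto
  have "sigma_length (segment_label a 0 s) < k"
    using not_less_Least[of s "\<lambda>t. k \<le> sigma_length (segment_label a 0 t)"] s
    by (simp add: t_def[symmetric])
  moreover have "sigma_length (lab (a s)) \<le> D" using assms(2,3) by (simp add: E_omega_def)
  ultimately show ?thesis using k
    by (intro exI[of _ t]) (simp add: s segment_label_Suc sigma_length_mult)
qed

section \<open>Paths of a given point\<close>

text \<open>The fiber over \<open>x\<close> with the intervals removed: here \<open>y\<close> stands for \<open>I\<^sub>i\<^sup>-\<^sup>1 x\<close>.\<close>

definition point_paths :: "edge set \<Rightarrow> nat \<Rightarrow> p1real \<Rightarrow> (nat \<Rightarrow> edge) set" where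
  "point_paths A i y = {a \<in> E_omega A i. \<forall>t. y \<in> cylinder (segment_label a 0 t)}"

text \<open>The product of the edge maps telescopes: only the interval of the starting node remains.\<close>

lemma moebius_B_word_ivl:
  assumes "a \<in> E_omega A i"
  shows "moebius (B_word I (map a [0..<t])) ` ivl (I (src (a t))) =
    moebius (I i) ` cylinder (segment_label a 0 t)"
proof -
  have "B_word I (map a [0..<t]) * I (src (a t)) = I i * Proj (segment_label a 0 t)"
  proof (induction t)
    case 0
    then show ?case using assms by (simp add: B_word_def Proj_one E_omega_def)
  next
    case (Suc t)
    have "tgt (a t) = src (a (Suc t))" using assms by (simp add: E_omega_def)
    then have "B_word I (map a [0..<Suc t]) * I (src (a (Suc t))) =
      B_word I (map a [0..<t]) * I (src (a t)) * Proj (lab (a t)) *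
        (psl_inv (I (src (a (Suc t)))) * I (src (a (Suc t))))"
      by (simp add: B_word_def B_edge_def mult.assoc)
    also have "\<dots> = I i * Proj (segment_label a 0 (Suc t))"
      using Suc by (simp add: psl_inv segment_label_Suc Proj_mult mult.assoc)
    finally show ?case .
  qed
  then show ?thesis
    unfolding ivl_def nonneg_points_def[symmetric] cylinder_def image_image moebius_mult[symmetric]
    by simp
qed

text \<open>The coding map is a definite description, so that it says something about \<open>x\<close> only once the
  intersection of the cylinders is known to be a single point.\<close>

lemma fiber_subset_point_paths:
  assumes "is_code n A"
  shows "fiber A I i x \<subseteq> point_paths A i (moebius (psl_inv (I i)) x)"
proof
  fix a assume "a \<in> fiber A I i x"
  then have a: "a \<in> E_omega A i" and x: "x = coding_map I a" by (auto simp: fiber_def)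
  have mem: "z \<in> moebius (I i) ` C \<longleftrightarrow> moebius (psl_inv (I i)) z \<in> C" for z C
    by (metis (no_types, lifting) imageE imageI moebius_inv)
  let ?P = "\<lambda>z. z \<in> (\<Inter>t. moebius (B_word I (map a [0..<t])) ` ivl (I (src (a t))))"
  have P: "?P z \<longleftrightarrow> (\<forall>t. moebius (psl_inv (I i)) z \<in> cylinder (segment_label a 0 t))" for z
    by (simp add: moebius_B_word_ivl[OF a] mem)
  have "\<exists>!y. \<forall>t. y \<in> cylinder (segment_label a 0 t)"
    by (rule cylinders_unique_point[OF path_length_unbounded[OF assms a]])
      (use segment_label_Suc in blast)
  then have "\<exists>!z. ?P z" unfolding P by (metis moebius_inv)
  then have "?P x" unfolding x coding_map_def by (rule theI')
  then show "a \<in> point_paths A i (moebius (psl_inv (I i)) x)"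
    using a unfolding P point_paths_def by simp
qed

lemma point_paths_normal_form:
  assumes "a \<in> point_paths A i y"
  obtains v e where "segment_label a 0 t = word v * flips e"
    "v \<in> point_words (sigma_length (segment_label a 0 t)) y"
proof -
  obtain v e where v: "set v \<subseteq> {L, N}" "segment_label a 0 t = word v * flips e"
    by (rule sigma_normal_form_flips)
  have "y \<in> cylinder (word v * flips e)" using assms v(2) by (metis (mono_tags, lifting) mem_Collect_eq point_paths_def)
  then have "v \<in> point_words (sigma_length (segment_label a 0 t)) y"
    using v by (simp add: point_words_def sigma_length_normal_form cylinder_flips)
  with v(2) that show ?thesis by blast
qed

lemma separating_prefix:
  fixes X :: "(nat \<Rightarrow> 'a) set"
  assumes "finite X"
  shows "\<exists>T. \<forall>a\<in>X. \<forall>b\<in>X. (\<forall>t<T. a t = b t) \<longrightarrow> a = b"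
proof -
  define d where "d = (\<lambda>(a, b). LEAST t :: nat. a t \<noteq> (b t :: 'a))"
  have "a = b" if "a \<in> X" "b \<in> X" "\<forall>t<Suc (\<Sum>p\<in>X \<times> X. d p). a t = b t" for a b
  proof (rule ccontr)
    assume "a \<noteq> b"
    then have "\<exists>t. a t \<noteq> b t" by (simp add: fun_eq_iff)
    then have "a (LEAST t. a t \<noteq> b t) \<noteq> b (LEAST t. a t \<noteq> b t)" by (rule LeastI_ex)
    then have "a (d (a, b)) \<noteq> b (d (a, b))" by (simp add: d_def)
    moreover have "d (a, b) \<le> (\<Sum>p\<in>X \<times> X. d p)"
      using assms that by (intro member_le_sum) auto
    ultimately show False using that(3) by auto
  qed
  then show ?thesis by blast
qed

text \<open>It suffices to bound finite sets \<open>X\<close> of paths. These are told apart by their first \<open>T\<close> edges, and the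
  threshold \<open>T D + 1\<close> on the label length is not reached within \<open>T\<close> edges. Hence the prefixes that just reach it are distinct, and
  their products lie in the set \<open>S\<close>.\<close>

lemma card_point_paths:
  assumes code: "is_code n A" and D: "\<forall>e\<in>A. sigma_length (lab e) \<le> D"
  shows "finite (point_paths A i y) \<and> card (point_paths A i y) \<le> 4 * D * n"
proof (rule finite_if_finite_subsets_card_bdd)
  fix X assume X: "X \<subseteq> point_paths A i y" "finite X"
  then have E: "a \<in> E_omega A i" if "a \<in> X" for a using that by (auto simp: point_paths_def)
  obtain T where T: "\<And>a b. a \<in> X \<Longrightarrow> b \<in> X \<Longrightarrow> (\<forall>t<T. a t = b t) \<Longrightarrow> a = b"
    using separating_prefix[OF X(2)] by blast
  define k where "k = T * D + 1"
  have "\<forall>a\<in>X. \<exists>t. sigma_length (segment_label a 0 t) \<in> {k..<k + D}"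
    using path_crossing_time[OF code E D, of _ k] by (simp add: k_def)
  then obtain \<tau> where \<tau>: "\<And>a. a \<in> X \<Longrightarrow> sigma_length (segment_label a 0 (\<tau> a)) \<in> {k..<k + D}" by metis
  have late: "T < \<tau> a" if "a \<in> X" for a
  proof (rule ccontr)
    assume "\<not> T < \<tau> a"
    then have "\<tau> a * D \<le> T * D" by (intro mult_le_mono1) simp
    then show False
      using \<tau>[OF that] path_length_le[OF E[OF that] D, of "\<tau> a"]
      unfolding k_def atLeastLessThan_iff by linarith
  qed
  define \<Phi> where "\<Phi> = (\<lambda>a. (i, segment_label a 0 (\<tau> a), src (a (\<tau> a))))"
  have prod: "edge_prod (map a [0..<\<tau> a]) = Some (\<Phi> a)" if "a \<in> X" for a
    using edge_prod_segment[OF E[OF that], of 0 "\<tau> a"] late[OF that] E[OF that]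
    by (simp add: \<Phi>_def E_omega_def)
  have "inj_on \<Phi> X"
  proof
    fix a b assume ab: "a \<in> X" "b \<in> X" "\<Phi> a = \<Phi> b"
    then have eq: "map a [0..<\<tau> a] = map b [0..<\<tau> b]"
      using code_unique[OF code E_omega_segment_subset[OF E[OF ab(1)]]
          E_omega_segment_subset[OF E[OF ab(2)]]] prod[OF ab(1)] prod[OF ab(2)] ab(3) by simp
    have "\<tau> a = \<tau> b" using arg_cong[OF eq, of length] by simp
    with eq have "\<forall>t<\<tau> a. a t = b t" by simp
    then show "a = b" using T[OF ab(1,2)] late[OF ab(1)] by simp
  qed
  define W where "W = (\<Union>m\<in>{k..<k + D}. point_words m y)"
  have "card W \<le> (\<Sum>m\<in>{k..<k + D}. card (point_words m y))"
    unfolding W_def by (rule card_UN_le) simp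
  also have "\<dots> \<le> (\<Sum>m\<in>{k..<k + D}. 2)" by (intro sum_mono card_point_words)
  finally have "card W \<le> 2 * D" by simp
  have "finite W" unfolding W_def by (simp add: finite_point_words)
  define S where "S = (\<lambda>(v, e, j). (i, word v * flips e, j)) ` (W \<times> (UNIV :: bool set) \<times> {..<n})"
  have "\<Phi> ` X \<subseteq> S"
  proof
    fix p assume "p \<in> \<Phi> ` X"
    then obtain a where a: "a \<in> X" "p = \<Phi> a" by blast
    obtain v e where v: "segment_label a 0 (\<tau> a) = word v * flips e"
      "v \<in> point_words (sigma_length (segment_label a 0 (\<tau> a))) y"
      using point_paths_normal_form a(1) X(1) by blast
    then have "v \<in> W" using \<tau>[OF a(1)] by (auto simp: W_def)
    moreover have "src (a (\<tau> a)) < n" by (rule path_node[OF code E[OF a(1)]])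
    ultimately show "p \<in> S"
      unfolding S_def a(2) \<Phi>_def v(1)
      by (intro image_eqI[of _ _ "(v, e, src (a (\<tau> a)))"]) simp_all
  qed
  moreover have "finite S" using \<open>finite W\<close> by (simp add: S_def)
  ultimately have "card X \<le> card S"
    using \<open>inj_on \<Phi> X\<close> by (intro card_inj_on_le)
  also have "\<dots> \<le> card (W \<times> (UNIV :: bool set) \<times> {..<n})"
    unfolding S_def using \<open>finite W\<close> by (intro card_image_le) simp
  also have "\<dots> = card W * (2 * n)" by (simp add: card_cartesian_product)
  also have "\<dots> \<le> (2 * D) * (2 * n)" using \<open>card W \<le> 2 * D\<close> by (rule mult_le_mono1)
  finally show "card X \<le> 4 * D * n" by simp
qed

section \<open>Purely periodic paths\<close>

text \<open>Moving one \<open>f\<close> past a word only interchanges \<open>l\<close> and \<open>n\<close>, after which the two \<open>f\<close> cancel.\<close>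

lemma square_unflipped: "\<exists>u. set u \<subseteq> {L, N} \<and> \<sigma> * \<sigma> = word u"
proof -
  obtain w e where w: "set w \<subseteq> {L, N}" "\<sigma> = word w * flips e" by (rule sigma_normal_form_flips)
  show ?thesis
  proof (cases e)
    case False
    then show ?thesis using w by (intro exI[of _ "w @ w"]) (simp add: flips_def word_mult)
  next
    case True
    obtain w' where w': "set w' \<subseteq> {L, N}" "word (F # w) = word (w' @ [F])" using F_commute[OF w(1)] by blast
    have "\<sigma> * \<sigma> = word w * word (F # w) * word [F]"
      using True w(2) by (simp add: flips_def word_mult)
    also have "\<dots> = word w * word w' * (word [F] * word [F])"
      unfolding w'(2) by (simp add: word_mult)
    also have "\<dots> = word (w @ w')" unfolding word_FF by (simp add: word_mult)
    finally have "\<sigma> * \<sigma> = word (w @ w')" .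
    then show ?thesis using w(1) w'(1) by (intro exI[of _ "w @ w'"]) simp
  qed
qed

lemma segment_label_periodic:
  assumes "\<And>t. a (t + m) = a t"
  shows "segment_label a 0 (q * m) = segment_label a 0 m ^ q"
proof (induction q)
  case (Suc q)
  have "[m..<m + q * m] = map (\<lambda>t. t + m) [0..<q * m]"
    by (simp add: map_add_upt add.commute)
  then have shift: "segment_label a m (m + q * m) = segment_label a 0 (q * m)"
    by (simp add: segment_label_def comp_def assms)
  show ?case using segment_label_split[of 0 m "m + q * m" a] Suc shift by simp
qed simp

text \<open>The function \<open>f\<close> in the proof records, for a prefix of \<open>b\<close> whose label has length between
  \<open>(q + 1) \<bar>u\<bar>\<close> and \<open>(q + 1) \<bar>u\<bar> + D\<close>, the excess length, the final \<open>f\<close> and the end node. For two such prefixes with equal records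
  the longer label is \<open>u\<^sup>r\<close> times the shorter one, which is also the label of \<open>r\<close> double periods of \<open>a\<close>
  followed by the shorter prefix.\<close>

lemma periodic_point_path_unique:
  assumes code: "is_code n A" and D: "\<forall>e\<in>A. sigma_length (lab e) \<le> D"
    and a: "a \<in> point_paths A i y" and per: "m > 0" "\<And>t. a (t + m) = a t"
    and b: "b \<in> point_paths A i y"
  shows "b = a"
proof -
  have Ea: "a \<in> E_omega A i" and Eb: "b \<in> E_omega A i" using a b by (auto simp: point_paths_def)
  \<comment> \<open>two periods instead of one, so that the label has no \<open>f\<close>\<close>
  have per2: "a (t + 2 * m) = a t" for t using per(2)[of t] per(2)[of "t + m"]
    by (simp add: mult_2 add.assoc)
  have src0: "src (a 0) = i" "src (b 0) = i" using Ea Eb by (auto simp: E_omega_def)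
  have per_src: "src (a (q * (2 * m))) = i" for q
  proof (induction q)
    case (Suc q)
    then show ?case using per2[of "q * (2 * m)"] by (simp add: add.commute)
  qed (simp add: src0)
  have "segment_label a 0 (2 * m) = segment_label a 0 m * segment_label a 0 m"
    using segment_label_periodic[of a m 2, OF per(2)] by (simp add: power2_eq_square)
  then obtain u where u: "set u \<subseteq> {L, N}" "segment_label a 0 (2 * m) = word u"
    using square_unflipped by metis
  have lab_a: "segment_label a 0 (q * (2 * m)) = word (word_power q u)" for q
    using segment_label_periodic[of a "2 * m" q, OF per2] u(2) by (simp add: word_word_power)
  have y: "y \<in> cylinder (word (word_power q u))" for q
    using a lab_a[of q] unfolding point_paths_def by (metis (mono_tags, lifting) mem_Collect_eq)
  have "sigma_length (word u) > 0"
    using code_loop_positive_length[OF code E_omega_segment_subset[OF Ea, of 0 "2 * m"]]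
      edge_prod_segment[OF Ea, of 0 "2 * m"] per(1) per_src[of 1] src0 u(2) by simp
  then have "u \<noteq> []" by (auto simp: word_Nil sigma_length_one)
  then have lu: "length u \<ge> 1" by (cases u) auto
  \<comment> \<open>\<open>Suc q\<close> rather than \<open>q\<close>, since a prefix must be nonempty to have a product\<close>
  have "\<exists>t v e. segment_label b 0 t = word v * flips e \<and> v \<in> point_words (length v) y \<and>
      length v \<in> {Suc q * length u..<Suc q * length u + D}" for q
  proof -
    obtain t where t: "sigma_length (segment_label b 0 t) \<in> {Suc q * length u..<Suc q * length u + D}"
      using path_crossing_time[OF code Eb D, of "Suc q * length u"] lu by fastforce
    obtain v e where v: "segment_label b 0 t = word v * flips e"
      "v \<in> point_words (sigma_length (segment_label b 0 t)) y"
      using point_paths_normal_form[OF b] by blast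
    moreover have "length v = sigma_length (segment_label b 0 t)" using v(2) by (simp add: point_words_def)
    ultimately show ?thesis using t by metis
  qed
  then obtain \<tau> v e where bq: "\<And>q. segment_label b 0 (\<tau> q) = word (v q) * flips (e q)"
    "\<And>q. v q \<in> point_words (length (v q)) y"
    "\<And>q. length (v q) \<in> {Suc q * length u..<Suc q * length u + D}" by metis
  define f where "f = (\<lambda>q. (length (v q) - Suc q * length u, e q, src (b (\<tau> q))))"
  have "f q \<in> {..D} \<times> (UNIV :: bool set) \<times> {..<n}" for q
    using bq(3)[of q] path_node[OF code Eb, of "\<tau> q"] unfolding f_def by auto
  then have "range f \<subseteq> {..D} \<times> (UNIV :: bool set) \<times> {..<n}" by blast
  then have "finite (range f)" by (rule finite_subset) simp
  then obtain q0 where "infinite {q \<in> UNIV. f q = f q0}"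
    using pigeonhole_infinite[of UNIV f] by auto
  then have recur: "\<exists>q>r. f q = f q0" for r unfolding infinite_nat_iff_unbounded by blast
  have \<tau>_pos: "\<tau> q > 0" for q
  proof (rule ccontr)
    assume "\<not> ?thesis"
    moreover have "sigma_length (segment_label b 0 (\<tau> q)) = length (v q)"
      using bq(1,2)[of q] by (simp add: point_words_def sigma_length_normal_form)
    ultimately show False using bq(3)[of q] lu by (simp add: sigma_length_one)
  qed
  have agree: "b s = a s" for s
  proof -
    obtain q where q: "q > q0 + s" "f q = f q0" using recur by blast
    define r where "r = q - q0"
    have r: "q = r + q0" "r > s" using q(1) by (simp_all add: r_def)
    have lens: "length (v q) = r * length u + length (v q0)"
    proof -
      have "length (v q) - Suc q * length u = length (v q0) - Suc q0 * length u"
        using q(2) by (simp add: f_def)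
      moreover have "Suc q * length u = r * length u + Suc q0 * length u"
        by (simp add: r(1) algebra_simps)
      moreover have "Suc q * length u \<le> length (v q)" "Suc q0 * length u \<le> length (v q0)"
        using bq(3)[of q] bq(3)[of q0] by (simp_all only: atLeastLessThan_iff)
      ultimately show ?thesis by linarith
    qed
    have vq: "v q = word_power r u @ v q0"
    proof -
      obtain Q where Q: "length (v q0) \<le> Q * length u"
        using lu by (metis mult.right_neutral mult_le_mono2)
      have "v q0 = take (length (v q0)) (word_power Q u)"
        using periodic_point_unique_word[OF u(1) y _ _ Q] bq(2)[of q0] by (simp add: point_words_def)
      moreover have "length (v q) \<le> (r + Q) * length u" using lens Q by (simp add: algebra_simps)
      then have "v q = take (length (v q)) (word_power (r + Q) u)"
        using periodic_point_unique_word[OF u(1) y] bq(2)[of q] by (simp add: point_words_def)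
      ultimately show ?thesis by (simp add: word_power_add lens)
    qed
    have rm: "0 < r * (2 * m)" using r(2) per(1) by simp
    have "edge_prod (map a [0..<r * (2 * m)]) = Some (i, word (word_power r u), i)"
      using edge_prod_segment[OF Ea rm] by (simp only: src0 per_src lab_a)
    moreover have pb: "edge_prod (map b [0..<\<tau> q']) = Some (i, word (v q') * flips (e q'), src (b (\<tau> q')))" for q'
      using edge_prod_segment[OF Eb \<tau>_pos] by (simp only: src0 bq(1))
    ultimately have "edge_prod (map a [0..<r * (2 * m)] @ map b [0..<\<tau> q0]) =
        Some (i, word (word_power r u) * (word (v q0) * flips (e q0)), src (b (\<tau> q0)))"
      using edge_prod_append by fastforce
    also have "\<dots> = edge_prod (map b [0..<\<tau> q])"
      using q(2) by (simp add: pb vq f_def word_mult[symmetric] mult.assoc)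
    finally have "map a [0..<r * (2 * m)] @ map b [0..<\<tau> q0] = map b [0..<\<tau> q]"
      using code_unique[OF code, of "map a [0..<r * (2 * m)] @ map b [0..<\<tau> q0]" "map b [0..<\<tau> q]"]
        E_omega_segment_subset[OF Ea] E_omega_segment_subset[OF Eb] pb by simp
    then have eq: "map b [0..<\<tau> q] = map a [0..<r * (2 * m)] @ map b [0..<\<tau> q0]" by (rule sym)
    have "r * 1 \<le> r * (2 * m)" using per(1) by (intro mult_le_mono2) simp
    then have "s < r * (2 * m)" using r(2) unfolding mult_1_right by (rule less_le_trans[rotated])
    moreover have "\<tau> q = r * (2 * m) + \<tau> q0" using arg_cong[OF eq, of length] by simp
    ultimately show ?thesis
      using arg_cong[OF eq, of "\<lambda>xs. xs ! s"] by (simp add: nth_append)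
  qed
  then show ?thesis by blast
qed

section \<open>Fibers of the coding map\<close>

theorem theorem2p13:
  fixes n :: nat and A :: "edge set"
  assumes "abstract_cf n A"
  shows "(\<exists>M::nat. M \<ge> 1 \<and>
           (\<forall>I. (\<forall>i<n. I i \<in> PSL2Z) \<longrightarrow>
              (\<forall>i\<^sub>0<n. \<forall>x\<^sub>0 \<in> attractor A I i\<^sub>0.
                 finite (fiber A I i\<^sub>0 x\<^sub>0) \<and> card (fiber A I i\<^sub>0 x\<^sub>0) \<le> M))) \<and>
         (\<forall>I. (\<forall>i<n. I i \<in> PSL2Z) \<longrightarrow>
            (\<forall>i\<^sub>0<n. \<forall>x\<^sub>0 \<in> attractor A I i\<^sub>0.
               (\<exists>a \<in> fiber A I i\<^sub>0 x\<^sub>0. purely_periodic a) \<longrightarrow>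
               card (fiber A I i\<^sub>0 x\<^sub>0) = 1))"
proof -
  have code: "is_code n A" and fin: "finite A" using assms by (auto simp: abstract_cf_def)
  define D where "D = (\<Sum>e\<in>A. sigma_length (lab e))"
  have D: "\<forall>e\<in>A. sigma_length (lab e) \<le> D"
    unfolding D_def using fin by (intro ballI member_le_sum) auto
  have bound: "finite (fiber A I i x) \<and> card (fiber A I i x) \<le> 4 * D * n + 1" for I i x
  proof -
    let ?P = "point_paths A i (moebius (psl_inv (I i)) x)"
    have "finite ?P \<and> card ?P \<le> 4 * D * n" by (rule card_point_paths[OF code D])
    moreover have "fiber A I i x \<subseteq> ?P" by (rule fiber_subset_point_paths[OF code])
    ultimately show ?thesis using finite_subset card_mono[of ?P "fiber A I i x"] by fastforce
  qed
  have unique: "card (fiber A I i x) = 1" if a: "a \<in> fiber A I i x" "purely_periodic a" for I i x a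
  proof -
    obtain w where w: "w \<noteq> []" "a = (\<lambda>t. w ! (t mod length w))" using a(2) by (auto simp: purely_periodic_def)
    have "b = a" if "b \<in> fiber A I i x" for b
      by (rule periodic_point_path_unique[OF code D, of a i "moebius (psl_inv (I i)) x" "length w"])
        (use fiber_subset_point_paths[OF code, of I i x] a(1) that w in auto)
    with a(1) have "fiber A I i x = {a}" by blast
    then show ?thesis by simp
  qed
  \<comment> \<open>adding 1 makes the bound positive even if \<open>D = 0\<close>\<close>
  show ?thesis
  proof (intro conjI exI[of _ "4 * D * n + 1"])
    show "1 \<le> 4 * D * n + 1" by simp
  qed (use bound unique in blast)+
qed

end
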